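(* For every positive integer $j$ and every $\epsilon>0$ there exists $n_{j,\epsilon}$ with the following property. Let $G=\mathbb{Z}^{r_0}\oplus\mathbb{Z}_{q_1}^{r_1}\oplus\cdots\oplus\mathbb{Z}_{q_k}^{r_k}$ be a finitely generated abelian group, where the $q_i$ are powers of (not necessarily distinct) primes, and let $\alpha$ be a positive integer. Let $G'=\mathbb{Z}_\alpha^{r_0}\oplus\mathbb{Z}_{q_1}^{r_1}\oplus\cdots\oplus\mathbb{Z}_{q_k}^{r_k}$, let $n=|G'|$, and suppose that $j$ is the number of elements of $G'$ of order at most $2$. Let $\mathcal S_m$ denote the collection of subsets of $\mathrm{Dih}(G_\alpha)$ of size $m$. If $n\ge n_{j,\epsilon}$ and $6\le m\le\left(\sqrt{2/7}-\epsilon\right)\sqrt n$, then there are (strictly) more MSTD sets than MDTS sets in $\mathcal S_m$.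
   Context: For an abelian group $G$, $\mathrm{Dih}(G)=\mathbb{Z}_2\ltimes G$ is the generalized dihedral group, where the nonidentity element of $\mathbb{Z}_2$ acts on $G$ by inversion; its elements are written $(z,g)$ with $z\in\{0,1\}$, $g\in G$. Elements of $G$ are written as tuples $(g_{0,1},\dots,g_{0,r_0},g_{1,1},\dots,g_{k,r_k})$ with $g_{0,b}\in\mathbb{Z}$ and $g_{a,b}\in\mathbb{Z}_{q_a}$ for $a>0$. $\mathrm{Dih}(G_\alpha)$ is the finite subset $\{(z,(g_{0,1},\dots,g_{0,r_0},\dots,g_{k,r_k}))\in\mathrm{Dih}(G): 0\le g_{0,b}<\alpha \text{ for all } b\}$ of $\mathrm{Dih}(G)$; it has $2n$ elements. For a finite subset $A$ of $\mathrm{Dih}(G)$ (with products taken in $\mathrm{Dih}(G)$), $A+A=\{a_1a_2:a_1,a_2\in A\}$ and $A-A=\{a_1a_2^{-1}:a_1,a_2\in A\}$. $A$ is MSTD if $|A+A|>|A-A|$, and MDTS if $|A+A|<|A-A|$. The identity element counts among the elements of order at most $2$. *)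

theory Defs
  imports
    Complex_Main
    "HOL-Algebra.Algebra"
    "HOL-Number_Theory.Prime_Powers"
begin

definition semidirect_product ::
    "('h, 'x) monoid_scheme \<Rightarrow> ('h \<Rightarrow> 'g \<Rightarrow> 'g) \<Rightarrow> ('g, 'y) monoid_scheme \<Rightarrow> ('h \<times> 'g) monoid"
  where "semidirect_product H \<phi> G =
    \<lparr>carrier = carrier H \<times> carrier G,
     monoid.mult = (\<lambda>(z, g) (w, h). (z \<otimes>\<^bsub>H\<^esub> w, g \<otimes>\<^bsub>G\<^esub> \<phi> z h)),
     one = (\<one>\<^bsub>H\<^esub>, \<one>\<^bsub>G\<^esub>)\<rparr>"

definition Dih :: "('g, 'y) monoid_scheme \<Rightarrow> (int \<times> 'g) monoid"
  where "Dih G =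
    semidirect_product (integer_mod_group 2) (\<lambda>z g. if z = 0 then g else inv\<^bsub>G\<^esub> g) G"

lemma group_Dih:
  fixes G (structure)
  assumes "comm_group G"
  shows "group (Dih G)"
proof -
  interpret comm_group G by fact
  have Dih_cases: "\<exists>z g. x = (z, g) \<and> g \<in> carrier G \<and> (z = 0 \<or> z = 1)"
    if "x \<in> carrier (Dih G)" for x
  proof -
    have "fst x = 0 \<or> fst x = 1"
      using that by (auto simp: Dih_def semidirect_product_def carrier_integer_mod_group)
    with that show ?thesis
      by (cases x) (auto simp: Dih_def semidirect_product_def)
  qed
  show ?thesis
  proof (rule groupI, goal_cases)
    case (3 x y z)
    then obtain a b c f g h where
      "x = (a, f)" "y = (b, g)" "z = (c, h)" "f \<in> carrier G" "g \<in> carrier G" "h \<in> carrier G"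
      "a = 0 \<or> a = 1" "b = 0 \<or> b = 1" "c = 0 \<or> c = 1"
      using Dih_cases by metis
    then show ?case
      by (elim disjE) (simp_all add: Dih_def semidirect_product_def m_assoc inv_mult)
  next
    case (5 x)
    then obtain z g where x: "x = (z, g)" "g \<in> carrier G" "z = 0 \<or> z = 1"
      using Dih_cases by blast
    show ?case
    proof (cases "z = 0")
      case True
      then show ?thesis using x
        by (intro bexI[of _ "(0, inv g)"])
           (auto simp: Dih_def semidirect_product_def carrier_integer_mod_group)
    next
      case False
      then show ?thesis using x
        by (intro bexI[of _ "(1, g)"])
           (auto simp: Dih_def semidirect_product_def carrier_integer_mod_group)
    qed
  qed (auto simp: Dih_def semidirect_product_def carrier_integer_mod_group)
qed

text \<open>
  The sum of \<open>r 0\<close> copies of \<open>C\<close> and, for \<open>1 \<le> a \<le> k\<close>, of \<open>r a\<close> copies of \<open>\<int>\<close> modulo \<open>q a\<close>.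
  The coordinate \<open>g\<^bsub>a,b\<^esub>\<close> of an element \<open>g\<close> is \<open>g (a, b)\<close>.  The value \<open>q 0\<close> is not used.
  The group \<open>G\<close> is obtained for \<open>C = integer_group\<close>, the finite group \<open>G'\<close> for
  \<open>C = integer_mod_group \<alpha>\<close>.
\<close>

definition sum_of_cyclic ::
    "int monoid \<Rightarrow> nat \<Rightarrow> (nat \<Rightarrow> nat) \<Rightarrow> (nat \<Rightarrow> nat) \<Rightarrow> (nat \<times> nat \<Rightarrow> int) monoid"
  where "sum_of_cyclic C k r q =
    product_group (SIGMA a:{0..k}. {1..r a})
      (\<lambda>(a, b). if a = 0 then C else integer_mod_group (q a))"

abbreviation fg_group :: "nat \<Rightarrow> (nat \<Rightarrow> nat) \<Rightarrow> (nat \<Rightarrow> nat) \<Rightarrow> (nat \<times> nat \<Rightarrow> int) monoid"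
  where "fg_group \<equiv> sum_of_cyclic integer_group"

definition Dih_box :: "nat \<Rightarrow> nat \<Rightarrow> (nat \<Rightarrow> nat) \<Rightarrow> (nat \<Rightarrow> nat) \<Rightarrow> (int \<times> (nat \<times> nat \<Rightarrow> int)) set"
  where "Dih_box \<alpha> k r q =
    {(z, g) \<in> carrier (Dih (fg_group k r q)). \<forall>b\<in>{1..r 0}. 0 \<le> g (0, b) \<and> g (0, b) < int \<alpha>}"

definition MSTD :: "('a, 'x) monoid_scheme \<Rightarrow> 'a set \<Rightarrow> bool"
  where "MSTD G A \<longleftrightarrow> card (A <#>\<^bsub>G\<^esub> A) > card (A <#>\<^bsub>G\<^esub> set_inv\<^bsub>G\<^esub> A)"

definition MDTS :: "('a, 'x) monoid_scheme \<Rightarrow> 'a set \<Rightarrow> bool"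
  where "MDTS G A \<longleftrightarrow> card (A <#>\<^bsub>G\<^esub> A) < card (A <#>\<^bsub>G\<^esub> set_inv\<^bsub>G\<^esub> A)"

lemma comm_group_sum_of_cyclic:
  assumes "comm_group C"
  shows "comm_group (sum_of_cyclic C k r q)"
proof (rule group.group_comm_groupI)
  show "group (sum_of_cyclic C k r q)"
    using assms unfolding sum_of_cyclic_def
    by (intro product_group) (auto simp: comm_group.axioms(2))
qed (use assms in \<open>force simp: sum_of_cyclic_def PiE_iff add.commute
       comm_monoid.m_comm[OF comm_group.axioms(1)] intro!: restrict_ext\<close>)

lemma card_Dih_box:
  assumes "\<alpha> > 0" "\<And>a. a \<in> {1..k} \<Longrightarrow> q a > 0"
  shows "card (Dih_box \<alpha> k r q) = 2 * order (sum_of_cyclic (integer_mod_group \<alpha>) k r q)"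
proof -
  have "Dih_box \<alpha> k r q = {0, 1} \<times> carrier (sum_of_cyclic (integer_mod_group \<alpha>) k r q)"
    using assms
    by (fastforce simp: Dih_box_def Dih_def semidirect_product_def sum_of_cyclic_def PiE_iff
        carrier_integer_mod_group integer_group_def split: if_splits)
  then show ?thesis
    by (simp add: order_def card_cartesian_product)
qed

end

theory Submission
  imports Defs
begin

text \<open>
  Write a subset \<open>A\<close> of \<open>Dih(G)\<close> as the rotations \<open>(0, x)\<close> with \<open>x\<close> in \<open>R\<close> and the reflections \<open>(1, x)\<close>
  with \<open>x\<close> in \<open>F\<close>, and let \<open>r\<close> and \<open>f\<close> be the sizes of \<open>R\<close> and \<open>F\<close>.  In additive notation, \<open>A + A\<close> has
  the rotations \<open>(R + R) \<union> (F - F)\<close> and the reflections \<open>(F + R) \<union> (F - R)\<close>, whereas \<open>A - A\<close> has the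
  rotations \<open>(R - R) \<union> (F - F)\<close> and only the reflections \<open>F + R\<close>, because a reflection is its own
  inverse.  If \<open>F\<close> is nonempty and no accidental coincidences occur, then
  \<open>2 (|A + A| - |A - A|) = r (2 f + 3 - r)\<close>; for nonempty \<open>F\<close> it is always at least this number minus a
  weighted count \<open>L\<close> of coincidences (\<open>MSTD_dihedral_set\<close>).  In terms of \<open>m = r + f\<close> and
  \<open>d = r - f\<close>, four times the main term is \<open>(m + d) (m + 6 - 3 d)\<close>.  So \<open>A\<close> is MSTD unless it is quite
  unbalanced or has many coincidences.

  Both are unlikely for a uniformly random \<open>m\<close>-subset.  The mean of \<open>d\<^sup>2\<close> is at most \<open>m\<close>
  (\<open>sum_square_balanced_signs_le\<close>).  A coincidence of four distinct elements is determined by three of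
  them and is contained in \<open>A\<close> with probability at most \<open>(m / (2 n)) ^ 4\<close>; together with the
  coincidences of fewer elements, the mean of \<open>L\<close> is at most
  \<open>(3/8 m\<^sup>4 + 5/4 m\<^sup>3 + 3/2 j m\<^sup>2) / n\<close> (\<open>sum_coincidences_le\<close>).  The number \<open>j\<close> enters because an
  element of the box is determined by its square only up to \<open>j\<close> choices.

  Finally \<open>7 m\<^sup>2 \<le> 2 n\<close>, and Markov's inequality for a combination of \<open>d\<^sup>2\<close> and \<open>L\<close> shows that fewer than
  half of the sets can fail to be MSTD (\<open>card_MDTS_less_card_MSTD\<close>).  For \<open>m < 1000 j\<close> the mean of \<open>L\<close> is
  negligible when \<open>n\<close> is large, and \<open>3 |d| \<ge> m + 6\<close> has probability at most
  \<open>9 m / (m + 6)\<^sup>2 \<le> 3 / 8\<close>.  For \<open>m \<ge> 1000 j\<close> the deviation \<open>d\<close> is negligible compared with \<open>m\<close>, and the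
  mean of \<open>L\<close>, at most about \<open>3/28 m\<^sup>2\<close>, is less than half of the main term \<open>m\<^sup>2 / 4\<close>.
\<close>

section \<open>Random subsets of prescribed size\<close>

lemma card_supersets_of_size:
  assumes "finite U" and "K \<subseteq> U" and "card K \<le> m"
  shows "card {A. K \<subseteq> A \<and> A \<subseteq> U \<and> card A = m} = (card U - card K) choose (m - card K)"
proof -
  have fin: "finite K"
    using assms finite_subset by blast
  have bij: "bij_betw (\<lambda>C. C \<union> K) {C. C \<subseteq> U - K \<and> card C = m - card K}
    {A. K \<subseteq> A \<and> A \<subseteq> U \<and> card A = m}"
  proof (rule bij_betw_byWitness[where f' = "\<lambda>A. A - K"])
    have "card (C \<union> K) = m" if "C \<subseteq> U - K" "card C = m - card K" for C
    proof -
      have "finite C" "C \<inter> K = {}"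
        using that(1) assms(1) finite_subset[of C U] by auto
      then show ?thesis
        using that(2) assms(3) fin by (simp add: card_Un_disjoint)
    qed
    then show "(\<lambda>C. C \<union> K) ` {C. C \<subseteq> U - K \<and> card C = m - card K}
        \<subseteq> {A. K \<subseteq> A \<and> A \<subseteq> U \<and> card A = m}"
      using assms by auto
    show "(\<lambda>A. A - K) ` {A. K \<subseteq> A \<and> A \<subseteq> U \<and> card A = m}
        \<subseteq> {C. C \<subseteq> U - K \<and> card C = m - card K}"
      using fin by (auto simp: card_Diff_subset)
  qed auto
  have "card {A. K \<subseteq> A \<and> A \<subseteq> U \<and> card A = m}
      = card {C. C \<subseteq> U - K \<and> card C = m - card K}"
    using bij_betw_same_card[OF bij] by simp
  also have "\<dots> = card (U - K) choose (m - card K)"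
    using assms by (intro n_subsets) auto
  finally show ?thesis
    using assms fin by (simp add: card_Diff_subset)
qed

text \<open>
  Removing one point from both the ground set and the subset multiplies the binomial coefficient by
  \<open>(m - k) / (N - k)\<close>, which is at most \<open>m / N\<close>.  In probabilistic terms: a uniformly random
  \<open>m\<close>-subset of an \<open>N\<close>-set contains \<open>k\<close> given points with probability at most \<open>(m / N) ^ k\<close>.
\<close>

lemma binomial_diff_le:
  assumes "k \<le> m" and "m \<le> N"
  shows "real ((N - k) choose (m - k)) \<le> real (N choose m) * (real m / real N) ^ k"
  using assms(1)
proof (induction k)
  case 0
  then show ?case by simp
next
  case (Suc k)
  have N: "0 < N - k" and m: "0 < m - k"
    using Suc.prems assms by auto
  have "(m - k) * ((N - k) choose (m - k)) = (N - k) * ((N - Suc k) choose (m - Suc k))"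
    using times_binomial_minus1_eq[OF m, of "N - k"] by simp
  then have "real (m - k) * real ((N - k) choose (m - k))
      = real (N - k) * real ((N - Suc k) choose (m - Suc k))"
    by (metis of_nat_mult)
  then have "real ((N - Suc k) choose (m - Suc k))
      = real (m - k) / real (N - k) * real ((N - k) choose (m - k))"
    using N by (simp add: field_simps)
  also have "\<dots> \<le> real m / real N * (real (N choose m) * (real m / real N) ^ k)"
  proof (rule mult_mono)
    show "real (m - k) / real (N - k) \<le> real m / real N"
    proof -
      have "real (m - k) * real N = real m * real N - real k * real N"
        using Suc.prems by (simp add: of_nat_diff left_diff_distrib)
      also have "\<dots> \<le> real m * real N - real k * real m"
        using assms(2) by (simp add: mult_left_mono)
      also have "\<dots> = real m * real (N - k)"
        using Suc.prems assms(2) by (simp add: of_nat_diff right_diff_distrib)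
      finally show ?thesis
        using N by (simp add: divide_simps)
    qed
  qed (use Suc in auto)
  finally show ?case
    by (simp add: mult_ac)
qed

lemma card_supersets_of_size_le:
  assumes "finite U" and "K \<subseteq> U" and "m \<le> card U"
  shows "real (card {A. K \<subseteq> A \<and> A \<subseteq> U \<and> card A = m})
    \<le> real (card U choose m) * (real m / real (card U)) ^ card K"
proof (cases "card K \<le> m")
  case True
  then show ?thesis
    using assms by (simp add: card_supersets_of_size binomial_diff_le)
next
  case False
  have "\<not> K \<subseteq> A" if "A \<subseteq> U" "card A = m" for A
    using that False assms by (meson card_mono finite_subset)
  then have none: "{A. K \<subseteq> A \<and> A \<subseteq> U \<and> card A = m} = {}"
    by blast
  show ?thesis
    unfolding none by simp
qed

lemma sum_indicator_eq_card:
  assumes "finite I"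
  shows "(\<Sum>t\<in>I. if P t then 1 else (0::real)) = real (card {t \<in> I. P t})"
  using sum.inter_filter[OF assms, of "\<lambda>_. 1::real" P] by simp

text \<open>
  Linearity of expectation for counting patterns.  \<open>I\<close> is a set of patterns, \<open>supp t\<close> the set of
  points that the pattern \<open>t\<close> occupies, and \<open>Q A\<close> the set of patterns that occur in \<open>A\<close>; the bound
  is (number of \<open>m\<close>-subsets) times (number of patterns) times the probability of one pattern.
\<close>

lemma sum_card_supported_le:
  assumes U: "finite U" "m \<le> card U"
    and I: "finite I" "card I \<le> c"
    and supp: "\<And>t. t \<in> I \<Longrightarrow> supp t \<subseteq> U" "\<And>t. t \<in> I \<Longrightarrow> card (supp t) = k"
    and Q: "\<And>A. A \<subseteq> U \<Longrightarrow> Q A = {t \<in> I. supp t \<subseteq> A}"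
  shows "(\<Sum>A | A \<subseteq> U \<and> card A = m. real (card (Q A)))
    \<le> real (card U choose m) * (real c * (real m / real (card U)) ^ k)"
proof -
  let ?S = "{A. A \<subseteq> U \<and> card A = m}"
  have fin: "finite ?S"
    using U by simp
  have "(\<Sum>A\<in>?S. real (card (Q A))) = (\<Sum>A\<in>?S. \<Sum>t\<in>I. if supp t \<subseteq> A then 1 else 0)"
    unfolding sum_indicator_eq_card[OF I(1)] by (intro sum.cong) (simp_all add: Q)
  also have "\<dots> = (\<Sum>t\<in>I. \<Sum>A\<in>?S. if supp t \<subseteq> A then 1 else 0)"
    by (rule sum.swap)
  also have "\<dots> = (\<Sum>t\<in>I. real (card {A. supp t \<subseteq> A \<and> A \<subseteq> U \<and> card A = m}))"
    unfolding sum_indicator_eq_card[OF fin] by (simp add: conj_commute conj_left_commute)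
  also have "\<dots> \<le> (\<Sum>t\<in>I. real (card U choose m) * (real m / real (card U)) ^ k)"
    using card_supersets_of_size_le[OF U(1) supp(1) U(2)] supp(2)
    by (intro sum_mono) auto
  also have "\<dots> = real (card I) * (real (card U choose m) * (real m / real (card U)) ^ k)"
    by simp
  also have "\<dots> \<le> real c * (real (card U choose m) * (real m / real (card U)) ^ k)"
    using I by (intro mult_right_mono) auto
  finally show ?thesis
    by (simp add: mult_ac)
qed

text \<open>
  Second moment of a sum of \<open>m\<close> signs drawn without replacement from a balanced population.  In
  \<open>(sum \<sigma> A)\<^sup>2\<close> all off-diagonal pairs occur in equally many sets \<open>A\<close>, say \<open>N\<^sub>2\<close> many; since the signs
  add up to \<open>0\<close>, the off-diagonal products add up to minus the number of points, so that these
  pairs contribute negatively and only the diagonal is left.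
\<close>

lemma sum_square_balanced_signs_le:
  fixes \<sigma> :: "'a \<Rightarrow> real"
  assumes U: "finite U" "m \<le> card U" "2 \<le> m"
    and \<sigma>: "\<And>b. b \<in> U \<Longrightarrow> (\<sigma> b)\<^sup>2 = 1" "sum \<sigma> U = 0"
  shows "(\<Sum>A | A \<subseteq> U \<and> card A = m. (sum \<sigma> A)\<^sup>2) \<le> real (card U choose m) * real m"
proof -
  let ?S = "{A. A \<subseteq> U \<and> card A = m}"
  let ?N2 = "real ((card U - 2) choose (m - 2))"
  let ?in = "\<lambda>b c A. if {b, c} \<subseteq> A then 1 else (0::real)"
  have fin: "finite ?S"
    using U by simp
  have count: "(\<Sum>A\<in>?S. ?in b c A) = real (card {A. {b, c} \<subseteq> A \<and> A \<subseteq> U \<and> card A = m})" for b c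
    unfolding sum_indicator_eq_card[OF fin] by (simp add: conj_commute conj_left_commute)
  have off: "(\<Sum>A\<in>?S. ?in b c A) = ?N2" if "b \<in> U" "c \<in> U" "b \<noteq> c" for b c
    unfolding count using that U card_supersets_of_size[of U "{b, c}" m]
    by (simp add: card_insert_if numeral_2_eq_2)
  have diag: "(\<Sum>A\<in>?S. ?in b b A) \<le> real (card U choose m) * (real m / real (card U))"
    if "b \<in> U" for b
    unfolding count using that U card_supersets_of_size_le[of U "{b, b}" m] by simp
  have "(\<Sum>A\<in>?S. (sum \<sigma> A)\<^sup>2) = (\<Sum>A\<in>?S. \<Sum>b\<in>U. \<Sum>c\<in>U. \<sigma> b * \<sigma> c * ?in b c A)"
  proof (rule sum.cong[OF refl])
    fix A assume "A \<in> ?S"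
    then have "A \<subseteq> U" by simp
    then have *: "sum \<sigma> A = (\<Sum>b\<in>U. if b \<in> A then \<sigma> b else 0)"
      using U(1) sum.inter_filter[OF U(1), of \<sigma> "\<lambda>b. b \<in> A"] by (simp add: Int_absorb1 flip: Int_def)
    show "(sum \<sigma> A)\<^sup>2 = (\<Sum>b\<in>U. \<Sum>c\<in>U. \<sigma> b * \<sigma> c * ?in b c A)"
      unfolding * power2_eq_square sum_product by (intro sum.cong refl) auto
  qed
  also have "\<dots> = (\<Sum>b\<in>U. \<Sum>A\<in>?S. \<Sum>c\<in>U. \<sigma> b * \<sigma> c * ?in b c A)"
    by (rule sum.swap)
  also have "\<dots> = (\<Sum>b\<in>U. \<Sum>c\<in>U. \<Sum>A\<in>?S. \<sigma> b * \<sigma> c * ?in b c A)"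
    by (intro sum.cong refl sum.swap)
  also have "\<dots> = (\<Sum>b\<in>U. \<Sum>c\<in>U. \<sigma> b * \<sigma> c * (\<Sum>A\<in>?S. ?in b c A))"
    by (simp only: sum_distrib_left)
  \<comment> \<open>Giving the diagonal the count \<open>?N2\<close> as well makes the double sum a multiple of \<open>(sum \<sigma> U)\<^sup>2 = 0\<close>.\<close>
  also have "\<dots> = (\<Sum>b\<in>U. \<Sum>c\<in>U. \<sigma> b * \<sigma> c * ?N2
      + (if b = c then (\<Sum>A\<in>?S. ?in b b A) - ?N2 else 0))"
  proof (intro sum.cong refl)
    fix b c assume bc: "b \<in> U" "c \<in> U"
    show "\<sigma> b * \<sigma> c * (\<Sum>A\<in>?S. ?in b c A)
      = \<sigma> b * \<sigma> c * ?N2 + (if b = c then (\<Sum>A\<in>?S. ?in b b A) - ?N2 else 0)"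
    proof (cases "b = c")
      case True
      then show ?thesis
        using \<sigma>(1)[OF bc(1)] by (simp add: power2_eq_square)
    next
      case False
      then show ?thesis
        using off[OF bc False] by simp
    qed
  qed
  also have "\<dots> = (\<Sum>b\<in>U. \<Sum>c\<in>U. \<sigma> b * \<sigma> c * ?N2) + (\<Sum>b\<in>U. (\<Sum>A\<in>?S. ?in b b A) - ?N2)"
    using U(1) by (simp add: sum.distrib)
  also have "(\<Sum>b\<in>U. \<Sum>c\<in>U. \<sigma> b * \<sigma> c * ?N2) = (\<Sum>b\<in>U. \<Sum>c\<in>U. \<sigma> b * \<sigma> c) * ?N2"
    by (simp only: sum_distrib_right)
  also have "(\<Sum>b\<in>U. \<Sum>c\<in>U. \<sigma> b * \<sigma> c) = (sum \<sigma> U)\<^sup>2"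
    by (simp only: power2_eq_square sum_product)
  also have "(sum \<sigma> U)\<^sup>2 * ?N2 + (\<Sum>b\<in>U. (\<Sum>A\<in>?S. ?in b b A) - ?N2)
      = (\<Sum>b\<in>U. (\<Sum>A\<in>?S. ?in b b A) - ?N2)"
    by (simp only: \<sigma>(2) power2_eq_square mult_zero_left add_0_left)
  also have "\<dots> \<le> (\<Sum>b\<in>U. real (card U choose m) * (real m / real (card U)))"
  proof (rule sum_mono)
    fix b assume "b \<in> U"
    from diag[OF this]
    show "(\<Sum>A\<in>?S. ?in b b A) - ?N2 \<le> real (card U choose m) * (real m / real (card U))"
      by linarith
  qed
  also have "\<dots> = real (card U choose m) * real m"
    using U by auto
  finally show ?thesis .
qed

section \<open>Coincidences among products in an abelian group\<close>

lemma card_le_times_card_image: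
  assumes "finite W" and "\<And>p. p \<in> W \<Longrightarrow> card {q \<in> W. h q = h p} \<le> k"
  shows "card W \<le> k * card (h ` W)"
proof -
  have "card W = (\<Sum>v\<in>h ` W. card {q \<in> W. h q = v})"
    using sum.image_gen[OF assms(1), of "\<lambda>_. 1::nat" h] by simp
  also have "\<dots> \<le> of_nat (card (h ` W)) * k"
    by (rule sum_bounded_above) (use assms(2) in auto)
  finally show ?thesis
    by (simp add: mult.commute)
qed

lemma card_off_diagonal:
  assumes "finite R"
  shows "card {(x, y). x \<in> R \<and> y \<in> R \<and> x \<noteq> y} = card R * card R - card R"
proof -
  have "{(x, y). x \<in> R \<and> y \<in> R \<and> x \<noteq> y} = R \<times> R - (\<lambda>x. (x, x)) ` R"
    by auto
  moreover have "card ((\<lambda>x. (x, x)) ` R) = card R"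
    by (rule card_image) (auto simp: inj_on_def)
  moreover have "(\<lambda>x. (x, x)) ` R \<subseteq> R \<times> R"
    by auto
  ultimately show ?thesis
    using assms by (simp add: card_Diff_subset card_cartesian_product)
qed

lemma card_subset_add_card_Diff:
  assumes "finite S" and "T \<subseteq> S"
  shows "card S = card T + card (S - T)"
  using assms by (metis card_Diff_subset card_mono finite_subset le_add_diff_inverse)

lemma card_Un4_le:
  assumes "W \<subseteq> f ` A \<union> g ` B \<union> h ` C \<union> i ` D" "finite A" "finite B" "finite C" "finite D"
  shows "card W \<le> card A + card B + card C + card D"
proof -
  have "card W \<le> card (f ` A \<union> g ` B \<union> h ` C \<union> i ` D)"
    using assms by (intro card_mono) auto
  also have "\<dots> \<le> card (f ` A) + card (g ` B) + card (h ` C) + card (i ` D)"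
    by (meson add_le_mono1 card_Un_le le_trans)
  also have "\<dots> \<le> card A + card B + card C + card D"
    using assms by (intro add_mono card_image_le)
  finally show ?thesis .
qed

context comm_group
begin

text \<open>
  \<open>R\<close> and \<open>F\<close> stand for the rotations and the reflections of a subset of the dihedral group.  A sum or
  difference that is hit more often than forced comes from one of three relations: \<open>x y = g f\<inverse>\<close>
  (mixed), \<open>x y = u v\<close> (rotation), \<open>f x\<inverse> = g y\<inverse>\<close> (quotient), with \<open>x, y, u, v\<close> in \<open>R\<close> and
  \<open>f, g\<close> in \<open>F\<close>.  Each relation is split according to which of its elements agree, because the number
  of distinct elements decides how likely it is in a random set.  All of them are written without
  inverses.
\<close>

definition mixed_quads :: "'a set \<Rightarrow> 'a set \<Rightarrow> ('a \<times> 'a \<times> 'a \<times> 'a) set"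
  where "mixed_quads R F =
    {(x, y, f, g). x \<in> R \<and> y \<in> R \<and> f \<in> F \<and> g \<in> F \<and> x \<noteq> y \<and> f \<noteq> g \<and> x \<otimes> y \<otimes> f = g}"

definition mixed_squares :: "'a set \<Rightarrow> 'a set \<Rightarrow> ('a \<times> 'a \<times> 'a) set"
  where "mixed_squares R F =
    {(x, f, g). x \<in> R \<and> f \<in> F \<and> g \<in> F \<and> f \<noteq> g \<and> x \<otimes> x \<otimes> f = g}"

definition mixed_inverses :: "'a set \<Rightarrow> 'a set \<Rightarrow> ('a \<times> 'a \<times> 'a) set"
  where "mixed_inverses R F =
    {(x, y, f). x \<in> R \<and> y \<in> R \<and> f \<in> F \<and> x \<noteq> y \<and> x \<otimes> y = \<one>}"

definition mixed_involutions :: "'a set \<Rightarrow> 'a set \<Rightarrow> ('a \<times> 'a) set"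
  where "mixed_involutions R F = {(x, f). x \<in> R \<and> f \<in> F \<and> x \<otimes> x = \<one>}"

definition rotation_quads :: "'a set \<Rightarrow> ('a \<times> 'a \<times> 'a \<times> 'a) set"
  where "rotation_quads R =
    {(x, y, u, v). x \<in> R \<and> y \<in> R \<and> u \<in> R \<and> v \<in> R \<and> distinct [x, y, u, v] \<and> x \<otimes> y = u \<otimes> v}"

definition rotation_squares :: "'a set \<Rightarrow> ('a \<times> 'a \<times> 'a) set"
  where "rotation_squares R =
    {(x, u, v). x \<in> R \<and> u \<in> R \<and> v \<in> R \<and> distinct [x, u, v] \<and> x \<otimes> x = u \<otimes> v}"

definition equal_squares :: "'a set \<Rightarrow> ('a \<times> 'a) set"
  where "equal_squares R = {(x, y). x \<in> R \<and> y \<in> R \<and> x \<noteq> y \<and> x \<otimes> x = y \<otimes> y}"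

definition quotient_quads :: "'a set \<Rightarrow> 'a set \<Rightarrow> ('a \<times> 'a \<times> 'a \<times> 'a) set"
  where "quotient_quads R F =
    {(x, y, f, g). x \<in> R \<and> y \<in> R \<and> f \<in> F \<and> g \<in> F \<and> x \<noteq> y \<and> f \<noteq> g \<and> f \<otimes> y = g \<otimes> x}"

lemmas coincidence_defs =
  mixed_quads_def mixed_squares_def mixed_inverses_def mixed_involutions_def
  rotation_quads_def rotation_squares_def equal_squares_def quotient_quads_def

lemma finite_coincidences:
  assumes "finite R" "finite F"
  shows "finite (mixed_quads R F)" "finite (mixed_squares R F)" "finite (mixed_inverses R F)"
    "finite (mixed_involutions R F)" "finite (rotation_quads R)" "finite (rotation_squares R)"
    "finite (equal_squares R)" "finite (quotient_quads R F)"
proof -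
  have subs: "mixed_quads R F \<subseteq> R \<times> R \<times> F \<times> F" "mixed_squares R F \<subseteq> R \<times> F \<times> F"
    "mixed_inverses R F \<subseteq> R \<times> R \<times> F" "mixed_involutions R F \<subseteq> R \<times> F"
    "rotation_quads R \<subseteq> R \<times> R \<times> R \<times> R" "rotation_squares R \<subseteq> R \<times> R \<times> R"
    "equal_squares R \<subseteq> R \<times> R" "quotient_quads R F \<subseteq> R \<times> R \<times> F \<times> F"
    by (auto simp: coincidence_defs)
  show "finite (mixed_quads R F)" "finite (mixed_squares R F)" "finite (mixed_inverses R F)"
    "finite (mixed_involutions R F)" "finite (rotation_quads R)" "finite (rotation_squares R)"
    "finite (equal_squares R)" "finite (quotient_quads R F)"
    by (rule subs[THEN finite_subset], simp add: assms)+
qed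

text \<open>
  This turns membership in a quotient set into the inverse-free form of the relations above.
\<close>

lemma mem_quotients_iff:
  assumes "W \<subseteq> carrier G" "Y \<subseteq> carrier G" "v \<in> carrier G"
  shows "v \<in> W <#> set_inv Y \<longleftrightarrow> (\<exists>x\<in>W. \<exists>y\<in>Y. v \<otimes> y = x)"
proof
  assume "v \<in> W <#> set_inv Y"
  then obtain x y where "x \<in> W" "y \<in> Y" "v = x \<otimes> inv y"
    by (auto simp: set_mult_def SET_INV_def)
  moreover from this have "v \<otimes> y = x"
    using assms by (metis inv_solve_right' subsetD)
  ultimately show "\<exists>x\<in>W. \<exists>y\<in>Y. v \<otimes> y = x"
    by blast
next
  assume "\<exists>x\<in>W. \<exists>y\<in>Y. v \<otimes> y = x"
  then obtain x y where "x \<in> W" "y \<in> Y" "v \<otimes> y = x"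
    by blast
  moreover from this have "v = x \<otimes> inv y"
    using assms by (metis inv_solve_right subsetD)
  ultimately show "v \<in> W <#> set_inv Y"
    by (auto simp: set_mult_def SET_INV_def)
qed

text \<open>
  \<open>R\<close> has \<open>r (r + 1) / 2\<close> unordered products, and one of them is lost only if it is also a quotient from
  \<open>F\<close> or also a product of another pair.  The ordered pairs \<open>off\<close> of distinct elements without such a
  defect map two-to-one, the elements \<open>diag\<close> without such a defect map one-to-one, which is why a
  lost square is counted twice in the doubled inequality and a lost ordered pair once.
\<close>

lemma card_new_products_ge:
  assumes R: "finite R" "R \<subseteq> carrier G" and F: "finite F" "F \<subseteq> carrier G"
  shows "card R * card R + card R \<le> 2 * card ((R <#> R) - (F <#> set_inv F))
    + (card (mixed_quads R F) + card (mixed_inverses R F) + card (rotation_quads R)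
       + card (rotation_squares R))
    + 2 * (card (mixed_squares R F) + card (mixed_involutions R F) + card (rotation_squares R)
       + card (equal_squares R))"
proof -
  define Off where "Off = {(x, y). x \<in> R \<and> y \<in> R \<and> x \<noteq> y}"
  define off where "off = {(x, y) \<in> Off. x \<otimes> y \<notin> F <#> set_inv F \<and>
    (\<forall>u\<in>R. \<forall>v\<in>R. x \<otimes> y = u \<otimes> v \<longrightarrow> (u, v) = (x, y) \<or> (u, v) = (y, x))}"
  define diag where "diag = {x \<in> R. x \<otimes> x \<notin> F <#> set_inv F \<and>
    (\<forall>u\<in>R. \<forall>v\<in>R. x \<otimes> x = u \<otimes> v \<longrightarrow> u = x \<and> v = x)}"
  note fin = finite_coincidences[OF R(1) F(1)]
  have mem: "x \<in> carrier G" if "x \<in> R \<or> x \<in> F" for x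
    using that R F by blast
  have Off: "finite Off" "card Off = card R * card R - card R"
    using R card_off_diagonal[of R] unfolding Off_def
    by (auto intro: finite_subset[of _ "R \<times> R"])
  have off_sub: "off \<subseteq> Off" and diag_sub: "diag \<subseteq> R"
    by (auto simp: off_def diag_def)
  have "Off - off \<subseteq> (\<lambda>(x, y, f, g). (x, y)) ` mixed_quads R F
      \<union> (\<lambda>(x, y, f). (x, y)) ` mixed_inverses R F
      \<union> (\<lambda>(x, y, u, v). (x, y)) ` rotation_quads R
      \<union> (\<lambda>(u, x, y). (x, y)) ` rotation_squares R" (is "_ \<subseteq> ?U")
  proof
    fix p assume p: "p \<in> Off - off"
    then obtain x y where xy: "p = (x, y)" "x \<in> R" "y \<in> R" "x \<noteq> y"
      by (auto simp: Off_def)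
    consider "x \<otimes> y \<in> F <#> set_inv F" |
      u v where "u \<in> R" "v \<in> R" "x \<otimes> y = u \<otimes> v" "(u, v) \<noteq> (x, y)" "(u, v) \<noteq> (y, x)"
      using p xy unfolding off_def by blast
    then show "p \<in> ?U"
    proof cases
      case 1
      then obtain f g where fg: "f \<in> F" "g \<in> F" "x \<otimes> y \<otimes> f = g"
        using mem_quotients_iff[of F F "x \<otimes> y"] F mem xy by auto
      show ?thesis
      proof (cases "f = g")
        case True
        then have "x \<otimes> y = \<one>"
          using fg mem xy by (metis l_cancel_one m_closed m_comm)
        then have "(x, y, f) \<in> mixed_inverses R F"
          using xy fg by (simp add: mixed_inverses_def)
        from imageI[OF this, of "\<lambda>(x, y, f). (x, y)"] show ?thesis
          unfolding xy by simp
      next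
        case False
        then have "(x, y, f, g) \<in> mixed_quads R F"
          using xy fg by (simp add: mixed_quads_def)
        from imageI[OF this, of "\<lambda>(x, y, f, g). (x, y)"] show ?thesis
          unfolding xy by simp
      qed
    next
      case 2
      have "u \<noteq> x" "u \<noteq> y" "v \<noteq> x" "v \<noteq> y"
        using 2 mem xy by (metis l_cancel m_comm)+
      \<comment> \<open>If \<open>u = v\<close>, the relation is one between the square of \<open>u\<close> and the product of \<open>x\<close> and \<open>y\<close>.\<close>
      then have "(u, x, y) \<in> rotation_squares R \<or> (x, y, u, v) \<in> rotation_quads R"
        using 2 xy by (auto simp: rotation_squares_def rotation_quads_def)
      then show ?thesis
        using imageI[of "(u, x, y)" "rotation_squares R" "\<lambda>(u, x, y). (x, y)"]
          imageI[of "(x, y, u, v)" "rotation_quads R" "\<lambda>(x, y, u, v). (x, y)"]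
        unfolding xy by auto
    qed
  qed
  then have "card (Off - off) \<le> card (mixed_quads R F) + card (mixed_inverses R F)
      + card (rotation_quads R) + card (rotation_squares R)"
    by (rule card_Un4_le) (use fin in auto)
  then have off_ge: "card R * card R \<le> card R + card off + (card (mixed_quads R F)
      + card (mixed_inverses R F) + card (rotation_quads R) + card (rotation_squares R))"
    using Off(2) card_subset_add_card_Diff[OF Off(1) off_sub] by linarith
  have "R - diag \<subseteq> (\<lambda>(x, f, g). x) ` mixed_squares R F \<union> (\<lambda>(x, f). x) ` mixed_involutions R F
      \<union> (\<lambda>(x, u, v). x) ` rotation_squares R \<union> (\<lambda>(x, y). x) ` equal_squares R" (is "_ \<subseteq> ?U")
  proof
    fix x assume x: "x \<in> R - diag"
    consider "x \<otimes> x \<in> F <#> set_inv F" |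
      u v where "u \<in> R" "v \<in> R" "x \<otimes> x = u \<otimes> v" "u \<noteq> x \<or> v \<noteq> x"
      using x unfolding diag_def by blast
    then show "x \<in> ?U"
    proof cases
      case 1
      then obtain f g where fg: "f \<in> F" "g \<in> F" "x \<otimes> x \<otimes> f = g"
        using mem_quotients_iff[of F F "x \<otimes> x"] F mem x by auto
      show ?thesis
      proof (cases "f = g")
        case True
        then have "x \<otimes> x = \<one>"
          using fg mem x by (metis DiffD1 l_cancel_one m_closed m_comm)
        then have "(x, f) \<in> mixed_involutions R F"
          using x fg by (simp add: mixed_involutions_def)
        from imageI[OF this, of "\<lambda>(x, f). x"] show ?thesis
          by simp
      next
        case False
        then have "(x, f, g) \<in> mixed_squares R F"
          using x fg by (simp add: mixed_squares_def)
        from imageI[OF this, of "\<lambda>(x, f, g). x"] show ?thesis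
          by simp
      qed
    next
      case 2
      have "u \<noteq> x" "v \<noteq> x"
        using 2 mem x by (metis DiffD1 l_cancel m_comm)+
      then have "(x, u) \<in> equal_squares R \<or> (x, u, v) \<in> rotation_squares R"
        using 2 x by (auto simp: rotation_squares_def equal_squares_def)
      then show ?thesis
        using imageI[of "(x, u)" "equal_squares R" "\<lambda>(x, y). x"]
          imageI[of "(x, u, v)" "rotation_squares R" "\<lambda>(x, u, v). x"]
        by auto
    qed
  qed
  then have "card (R - diag) \<le> card (mixed_squares R F) + card (mixed_involutions R F)
      + card (rotation_squares R) + card (equal_squares R)"
    by (rule card_Un4_le) (use fin in auto)
  then have diag_ge: "card R \<le> card diag + (card (mixed_squares R F)
      + card (mixed_involutions R F) + card (rotation_squares R) + card (equal_squares R))"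
    using card_subset_add_card_Diff[OF R(1) diag_sub] by linarith
  have finoff: "finite off"
    using off_sub Off(1) by (rule finite_subset)
  have "card off \<le> 2 * card ((\<lambda>(x, y). x \<otimes> y) ` off)"
  proof (rule card_le_times_card_image[OF finoff])
    fix p assume p: "p \<in> off"
    obtain x y where xy: "p = (x, y)"
      by (cases p)
    have "{q \<in> off. (case q of (x, y) \<Rightarrow> x \<otimes> y) = (case p of (x, y) \<Rightarrow> x \<otimes> y)} \<subseteq> {(x, y), (y, x)}"
      using p xy by (auto simp: off_def Off_def)
    then have "card {q \<in> off. (case q of (x, y) \<Rightarrow> x \<otimes> y) = (case p of (x, y) \<Rightarrow> x \<otimes> y)}
        \<le> card {(x, y), (y, x)}"
      by (intro card_mono) auto
    also have "\<dots> \<le> 2"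
      using card_length[of "[(x, y), (y, x)]"] by simp
    finally show "card {q \<in> off. (case q of (x, y) \<Rightarrow> x \<otimes> y) = (case p of (x, y) \<Rightarrow> x \<otimes> y)} \<le> 2" .
  qed
  moreover have "card ((\<lambda>x. x \<otimes> x) ` diag) = card diag"
    by (rule card_image) (auto simp: inj_on_def diag_def)
  moreover have "card ((\<lambda>(x, y). x \<otimes> y) ` off) + card ((\<lambda>x. x \<otimes> x) ` diag)
      \<le> card ((R <#> R) - (F <#> set_inv F))"
  proof -
    have "(\<lambda>(x, y). x \<otimes> y) ` off \<inter> (\<lambda>x. x \<otimes> x) ` diag = {}"
      by (auto simp: off_def Off_def diag_def)
    moreover have "finite diag"
      using R by (simp add: diag_def)
    ultimately have "card ((\<lambda>(x, y). x \<otimes> y) ` off) + card ((\<lambda>x. x \<otimes> x) ` diag)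
        = card ((\<lambda>(x, y). x \<otimes> y) ` off \<union> (\<lambda>x. x \<otimes> x) ` diag)"
      using finoff by (subst card_Un_disjoint) auto
    also have "\<dots> \<le> card ((R <#> R) - (F <#> set_inv F))"
      using R by (intro card_mono) (auto simp: set_mult_def off_def Off_def diag_def)
    finally show ?thesis .
  qed
  ultimately have "card off + 2 * card diag \<le> 2 * card ((R <#> R) - (F <#> set_inv F))"
    by linarith
  with off_ge diag_ge show ?thesis
    unfolding distrib_left by linarith
qed

text \<open>
  The \<open>f r\<close> pairs in \<open>F \<times> R\<close> have distinct quotients, none of which is a product, except for pairs taking
  part in a coincidence.  Here \<open>f x\<inverse> = g y\<close> is again the mixed relation \<open>x y g = f\<close>, so the mixed
  coincidences harm both this count and that of the products.
\<close>

lemma card_new_reflections_ge: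
  assumes R: "finite R" "R \<subseteq> carrier G" and F: "finite F" "F \<subseteq> carrier G"
  shows "card F * card R \<le> card ((F <#> set_inv R) - (F <#> R))
    + (card (mixed_quads R F) + card (mixed_squares R F) + card (mixed_inverses R F)
       + card (mixed_involutions R F)) + card (quotient_quads R F)"
proof -
  define good where "good = {(f, x) \<in> F \<times> R. f \<otimes> inv x \<notin> F <#> R \<and>
    (\<forall>g\<in>F. \<forall>y\<in>R. f \<otimes> inv x = g \<otimes> inv y \<longrightarrow> g = f \<and> y = x)}"
  note fin = finite_coincidences[OF R(1) F(1)]
  have mem: "x \<in> carrier G" if "x \<in> R \<or> x \<in> F" for x
    using that R F by blast
  define Z where "Z = (\<lambda>(x, y, f, g). (g, x)) ` mixed_quads R F
      \<union> (\<lambda>(x, f, g). (g, x)) ` mixed_squares R F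
      \<union> (\<lambda>(x, y, f). (f, x)) ` mixed_inverses R F
      \<union> (\<lambda>(x, f). (f, x)) ` mixed_involutions R F"
  have "F \<times> R - good \<subseteq> Z \<union> (\<lambda>(x, y, f, g). (f, x)) ` quotient_quads R F"
  proof
    fix p assume p: "p \<in> F \<times> R - good"
    then obtain f x where fx: "p = (f, x)" "f \<in> F" "x \<in> R"
      by auto
    consider "f \<otimes> inv x \<in> F <#> R" |
      g y where "g \<in> F" "y \<in> R" "f \<otimes> inv x = g \<otimes> inv y" "g \<noteq> f \<or> y \<noteq> x"
      using p fx unfolding good_def by blast
    then show "p \<in> Z \<union> (\<lambda>(x, y, f, g). (f, x)) ` quotient_quads R F"
    proof cases
      case 1
      then obtain g y where gy: "g \<in> F" "y \<in> R" "f \<otimes> inv x = g \<otimes> y"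
        by (auto simp: set_mult_def)
      then have "f = g \<otimes> y \<otimes> x"
        using inv_solve_right'[of "g \<otimes> y" f x] mem fx by auto
      then have eq: "x \<otimes> y \<otimes> g = f"
        using gy mem fx by (simp add: m_ac)
      have "x \<otimes> y = \<one>" if "g = f"
        using that eq gy mem fx by (metis l_cancel_one m_closed m_comm)
      with eq have "(x, y, g, f) \<in> mixed_quads R F \<or> (x, g, f) \<in> mixed_squares R F
          \<or> (x, y, f) \<in> mixed_inverses R F \<or> (x, f) \<in> mixed_involutions R F"
        using fx gy by (auto simp: coincidence_defs)
      then show ?thesis
        using imageI[of "(x, y, g, f)" "mixed_quads R F" "\<lambda>(x, y, f, g). (g, x)"]
          imageI[of "(x, g, f)" "mixed_squares R F" "\<lambda>(x, f, g). (g, x)"]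
          imageI[of "(x, y, f)" "mixed_inverses R F" "\<lambda>(x, y, f). (f, x)"]
          imageI[of "(x, f)" "mixed_involutions R F" "\<lambda>(x, f). (f, x)"]
        unfolding fx Z_def by auto
    next
      case 2
      then have "f \<otimes> inv x \<otimes> y = g"
        using inv_solve_right[of "f \<otimes> inv x" g y] mem fx by auto
      moreover have "f \<otimes> inv x \<otimes> y = f \<otimes> y \<otimes> inv x"
        using 2(1,2) mem fx by (simp add: m_assoc m_comm[of "inv x" y])
      ultimately have eq: "f \<otimes> y = g \<otimes> x"
        using 2(1,2) mem fx inv_solve_right[of g "f \<otimes> y" x] by auto
      then have "g \<noteq> f" "y \<noteq> x"
        using 2 mem fx by (metis l_cancel r_cancel)+
      then have "(x, y, f, g) \<in> quotient_quads R F"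
        using 2 fx eq by (auto simp: quotient_quads_def)
      from imageI[OF this, of "\<lambda>(x, y, f, g). (f, x)"] show ?thesis
        unfolding fx by simp
    qed
  qed
  then have "card (F \<times> R - good) \<le> card (Z \<union> (\<lambda>(x, y, f, g). (f, x)) ` quotient_quads R F)"
    using fin by (intro card_mono) (auto simp: Z_def)
  also have "\<dots> \<le> card Z + card (quotient_quads R F)"
    using fin by (meson add_left_mono card_Un_le card_image_le le_trans)
  also have "card Z \<le> card (mixed_quads R F) + card (mixed_squares R F)
      + card (mixed_inverses R F) + card (mixed_involutions R F)"
    by (rule card_Un4_le[OF eq_refl[OF Z_def]]) (fact fin)+
  finally have bad: "card (F \<times> R - good) \<le> card (mixed_quads R F) + card (mixed_squares R F)
      + card (mixed_inverses R F) + card (mixed_involutions R F) + card (quotient_quads R F)"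
    by simp
  have "good \<subseteq> F \<times> R"
    by (auto simp: good_def)
  moreover have "finite (F \<times> R)"
    using R F by simp
  ultimately have "card F * card R = card good + card (F \<times> R - good)"
    by (metis card_cartesian_product card_subset_add_card_Diff)
  moreover have "card ((\<lambda>(f, x). f \<otimes> inv x) ` good) = card good"
    by (rule card_image) (auto simp: inj_on_def good_def)
  moreover have "card ((\<lambda>(f, x). f \<otimes> inv x) ` good) \<le> card ((F <#> set_inv R) - (F <#> R))"
    using R F by (intro card_mono) (auto simp: set_mult_def SET_INV_def good_def)
  ultimately show ?thesis
    using bad by linarith
qed

text \<open>
  The quotients \<open>x x\<inverse>\<close> are not new, because a nonempty \<open>F\<close> already contributes the identity.
\<close>

lemma card_new_quotients_le:
  assumes R: "finite R" "R \<subseteq> carrier G" and F: "F \<noteq> {}" "F \<subseteq> carrier G"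
  shows "card ((R <#> set_inv R) - (F <#> set_inv F)) \<le> card R * card R - card R"
proof -
  obtain f where f: "f \<in> F"
    using F by blast
  then have "\<one> \<otimes> f = f"
    using F by auto
  with f have one: "\<one> \<in> F <#> set_inv F"
    using F mem_quotients_iff[of F F \<one>] by blast
  have "(R <#> set_inv R) - (F <#> set_inv F)
      \<subseteq> (\<lambda>(x, y). x \<otimes> inv y) ` {(x, y). x \<in> R \<and> y \<in> R \<and> x \<noteq> y}"
  proof
    fix v assume v: "v \<in> (R <#> set_inv R) - (F <#> set_inv F)"
    then obtain x y where xy: "x \<in> R" "y \<in> R" "v = x \<otimes> inv y"
      by (auto simp: set_mult_def SET_INV_def)
    moreover have "x \<noteq> y"
      using v one xy R by auto
    ultimately show "v \<in> (\<lambda>(x, y). x \<otimes> inv y) ` {(x, y). x \<in> R \<and> y \<in> R \<and> x \<noteq> y}"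
      by auto
  qed
  moreover have fin: "finite {(x, y). x \<in> R \<and> y \<in> R \<and> x \<noteq> y}"
    by (rule finite_subset[of _ "R \<times> R"]) (use R in auto)
  ultimately have "card ((R <#> set_inv R) - (F <#> set_inv F))
      \<le> card {(x, y). x \<in> R \<and> y \<in> R \<and> x \<noteq> y}"
    by (meson card_image_le card_mono finite_imageI le_trans)
  then show ?thesis
    using R by (simp add: card_off_diagonal)
qed

end

section \<open>Sums and differences in the generalized dihedral group\<close>

definition dihedral_set :: "'a set \<Rightarrow> 'a set \<Rightarrow> (int \<times> 'a) set"
  where "dihedral_set R F = Pair 0 ` R \<union> Pair 1 ` F"

lemma card_dihedral_set:
  assumes "finite R" "finite F"
  shows "card (dihedral_set R F) = card R + card F"
proof -
  have "card (dihedral_set R F) = card (Pair (0::int) ` R) + card (Pair (1::int) ` F)"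
    unfolding dihedral_set_def
    by (rule card_Un_disjoint) (simp_all add: assms disjoint_iff image_iff)
  then show ?thesis
    by (simp add: card_image inj_on_def)
qed

context comm_group
begin

lemma carrier_Dih: "carrier (Dih G) = {0, 1} \<times> carrier G"
  by (auto simp: Dih_def semidirect_product_def carrier_integer_mod_group)

lemma mult_Dih:
  "(0, x) \<otimes>\<^bsub>Dih G\<^esub> (0, y) = (0, x \<otimes> y)"
  "(0, x) \<otimes>\<^bsub>Dih G\<^esub> (1, y) = (1, x \<otimes> y)"
  "(1, x) \<otimes>\<^bsub>Dih G\<^esub> (0, y) = (1, x \<otimes> inv y)"
  "(1, x) \<otimes>\<^bsub>Dih G\<^esub> (1, y) = (0, x \<otimes> inv y)"
  by (simp_all add: Dih_def semidirect_product_def)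

lemma inv_Dih:
  assumes "x \<in> carrier G"
  shows "inv\<^bsub>Dih G\<^esub> (0, x) = (0, inv x)" "inv\<^bsub>Dih G\<^esub> (1, x) = (1, x)"
proof -
  interpret D: group "Dih G"
    by (rule group_Dih) (rule comm_group_axioms)
  have one: "\<one>\<^bsub>Dih G\<^esub> = (0, \<one>)"
    by (simp add: Dih_def semidirect_product_def)
  show "inv\<^bsub>Dih G\<^esub> (0, x) = (0, inv x)"
    by (rule D.inv_equality) (use assms in \<open>auto simp: carrier_Dih mult_Dih one\<close>)
  show "inv\<^bsub>Dih G\<^esub> (1, x) = (1, x)"
    by (rule D.inv_equality) (use assms in \<open>auto simp: carrier_Dih mult_Dih one\<close>)
qed

text \<open>
  A reflection conjugates a rotation to its inverse and is an involution.  Hence a reflection times a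
  rotation gives a quotient, and so do two reflections.  For \<open>R' = R\<close>, \<open>F' = F\<close> the reflections in the
  product are \<open>F R \<union> F R\<inverse>\<close>; for the inverted set, where \<open>R' = R\<inverse>\<close>, both parts collapse to \<open>F R\<close>.
  This is the source of the surplus of sums.
\<close>

lemma product_dihedral_sets:
  assumes "R \<subseteq> carrier G" "F \<subseteq> carrier G" "R' \<subseteq> carrier G" "F' \<subseteq> carrier G"
  shows "dihedral_set R F <#>\<^bsub>Dih G\<^esub> dihedral_set R' F'
    = dihedral_set ((R <#> R') \<union> (F <#> set_inv F')) ((F' <#> R) \<union> (F <#> set_inv R'))"
proof -
  have "x \<otimes> y = y \<otimes> x" if "x \<in> R" "y \<in> F'" for x y
    using that assms m_comm by blast
  then have "R <#> F' = F' <#> R"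
    unfolding set_mult_def by (subst SUP_commute) simp
  moreover have "dihedral_set R F <#>\<^bsub>Dih G\<^esub> dihedral_set R' F'
      = dihedral_set ((R <#> R') \<union> (F <#> set_inv F')) ((R <#> F') \<union> (F <#> set_inv R'))"
    unfolding dihedral_set_def set_mult_def SET_INV_def UNION_singleton_eq_range
    by (simp add: mult_Dih image_image image_UN image_Un UN_Un_distrib Un_ac)
  ultimately show ?thesis
    by simp
qed

lemma set_inv_dihedral_set:
  assumes "R \<subseteq> carrier G" "F \<subseteq> carrier G"
  shows "set_inv\<^bsub>Dih G\<^esub> (dihedral_set R F) = dihedral_set (set_inv R) F"
proof -
  have "set_inv\<^bsub>Dih G\<^esub> (dihedral_set R F)
      = (\<lambda>x. inv\<^bsub>Dih G\<^esub> (0, x)) ` R \<union> (\<lambda>x. inv\<^bsub>Dih G\<^esub> (1, x)) ` F"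
    by (auto simp: dihedral_set_def SET_INV_def)
  also have "(\<lambda>x. inv\<^bsub>Dih G\<^esub> (0, x)) ` R = (\<lambda>x. (0, inv x)) ` R"
    by (rule image_cong) (use assms inv_Dih in auto)
  also have "(\<lambda>x. inv\<^bsub>Dih G\<^esub> (1, x)) ` F = (\<lambda>x. (1, x)) ` F"
    by (rule image_cong) (use assms inv_Dih in auto)
  also have "(\<lambda>x. (0, inv x)) ` R \<union> (\<lambda>x. (1, x)) ` F = dihedral_set (set_inv R) F"
    by (auto simp: dihedral_set_def SET_INV_def)
  finally show ?thesis .
qed

text \<open>
  The multiplicities say how much each kind of coincidence can lower the bound for
  \<open>2 (|A + A| - |A - A|)\<close>: they add the losses among the products of rotations to twice the losses
  among the new reflections.
\<close>

definition coincidences :: "'a set \<Rightarrow> 'a set \<Rightarrow> nat"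
  where "coincidences R F =
    3 * card (mixed_quads R F) + 2 * card (quotient_quads R F) + card (rotation_quads R)
    + 4 * card (mixed_squares R F) + 3 * card (mixed_inverses R F) + 3 * card (rotation_squares R)
    + 4 * card (mixed_involutions R F) + 2 * card (equal_squares R)"

text \<open>
  Both \<open>A + A\<close> and \<open>A - A\<close> contain the rotations \<open>F F\<inverse>\<close> and the reflections \<open>F R\<close>.  Beyond these,
  \<open>A + A\<close> has the sets \<open>S\<close> and \<open>T\<close> below and \<open>A - A\<close> has \<open>D\<close>.  Without coincidences,
  \<open>2 (|S| + |T| - |D|) = r (r + 1) + 2 f r - 2 r (r - 1) = r (2 f + 3 - r)\<close>.
\<close>

lemma MSTD_dihedral_set:
  assumes R: "finite R" "R \<subseteq> carrier G" and F: "finite F" "F \<subseteq> carrier G" "F \<noteq> {}"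
    and few: "int (coincidences R F) < int (card R) * (2 * int (card F) + 3 - int (card R))"
  shows "MSTD (Dih G) (dihedral_set R F)"
proof -
  define S where "S = (R <#> R) - (F <#> set_inv F)"
  define D where "D = (R <#> set_inv R) - (F <#> set_inv F)"
  define T where "T = (F <#> set_inv R) - (F <#> R)"
  have fin: "finite (R <#> R)" "finite (F <#> set_inv F)" "finite (R <#> set_inv R)"
    "finite (F <#> R)" "finite (F <#> set_inv R)"
    using R F by (auto simp: set_mult_def SET_INV_def)
  have card_Un_Diff: "card (V \<union> W) = card W + card (V - W)" if "finite V" "finite W" for V W :: "'a set"
    using that card_Un_disjoint[of W "V - W"] by (auto simp: Un_commute)
  have inv_sub: "set_inv R \<subseteq> carrier G"
    using R by (auto simp: SET_INV_def)
  have inv_inv: "set_inv (set_inv R) = R"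
    using R by (force simp: SET_INV_def)
  have "card (dihedral_set R F <#>\<^bsub>Dih G\<^esub> dihedral_set R F)
      = card (F <#> set_inv F) + card S + (card (F <#> R) + card T)"
    using R F fin by (simp add: product_dihedral_sets card_dihedral_set card_Un_Diff S_def T_def
        Un_commute[of "F <#> R"])
  moreover have "card (dihedral_set R F <#>\<^bsub>Dih G\<^esub> set_inv\<^bsub>Dih G\<^esub> (dihedral_set R F))
      = card (F <#> set_inv F) + card D + card (F <#> R)"
    using R F fin inv_sub by (simp add: set_inv_dihedral_set product_dihedral_sets inv_inv
        card_dihedral_set card_Un_Diff D_def)
  moreover have "card D < card S + card T"
  proof -
    let ?r = "card R" and ?f = "card F"
    have "?r \<le> ?r * ?r"
      by simp
    then have D: "int (card D) \<le> int ?r * int ?r - int ?r"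
      using card_new_quotients_le[OF R F(3,2)] unfolding D_def
      by (metis of_nat_diff of_nat_le_iff of_nat_mult)
    have S: "int ?r * int ?r + int ?r \<le> 2 * int (card S)
        + (int (card (mixed_quads R F)) + int (card (mixed_inverses R F))
          + int (card (rotation_quads R)) + int (card (rotation_squares R)))
        + 2 * (int (card (mixed_squares R F)) + int (card (mixed_involutions R F))
          + int (card (rotation_squares R)) + int (card (equal_squares R)))"
      using of_nat_mono[OF card_new_products_ge[OF R F(1,2), folded S_def], where 'a = int]
      by (simp only: of_nat_add of_nat_mult of_nat_numeral)
    have T: "int ?f * int ?r \<le> int (card T) + (int (card (mixed_quads R F))
          + int (card (mixed_squares R F)) + int (card (mixed_inverses R F))
          + int (card (mixed_involutions R F))) + int (card (quotient_quads R F))"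
      using of_nat_mono[OF card_new_reflections_ge[OF R F(1,2), folded T_def], where 'a = int]
      by (simp only: of_nat_add of_nat_mult of_nat_numeral)
    define rr fr where "rr = int ?r * int ?r" and "fr = int ?f * int ?r"
    have "int ?r * (2 * int ?f + 3 - int ?r) = (rr + int ?r) + 2 * fr - 2 * (rr - int ?r)"
      by (simp add: rr_def fr_def algebra_simps)
    with few have "int (coincidences R F) < (rr + int ?r) + 2 * fr - 2 * (rr - int ?r)"
      by simp
    moreover have "int (coincidences R F) = 3 * int (card (mixed_quads R F))
        + 2 * int (card (quotient_quads R F)) + int (card (rotation_quads R))
        + 4 * int (card (mixed_squares R F)) + 3 * int (card (mixed_inverses R F))
        + 3 * int (card (rotation_squares R)) + 4 * int (card (mixed_involutions R F))
        + 2 * int (card (equal_squares R))"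
      by (simp add: coincidences_def)
    ultimately have "2 * int (card D) < 2 * int (card S) + 2 * int (card T)"
      using S[folded rr_def] T[folded fr_def] D[folded rr_def]
      unfolding distrib_left right_diff_distrib by linarith
    then show ?thesis
      by linarith
  qed
  ultimately show ?thesis
    unfolding MSTD_def by linarith
qed

end

section \<open>The expected number of coincidences\<close>

lemma mem_dihedral_set [simp]:
  "(z, x) \<in> dihedral_set R F \<longleftrightarrow> z = 0 \<and> x \<in> R \<or> z = 1 \<and> x \<in> F"
  by (auto simp: dihedral_set_def)

lemma dihedral_set_vimage:
  assumes "A \<subseteq> dihedral_set B B"
  shows "A = dihedral_set (Pair 0 -` A) (Pair 1 -` A)"
proof (rule Set.set_eqI)
  fix a :: "int \<times> 'a"
  obtain z x where a: "a = (z, x)"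
    by (cases a)
  have "z = 0 \<or> z = 1" if "(z, x) \<in> A"
    using subsetD[OF assms that] by auto
  then show "a \<in> A \<longleftrightarrow> a \<in> dihedral_set (Pair 0 -` A) (Pair 1 -` A)"
    unfolding a by auto
qed

lemma vimage_subset_of_dihedral_set:
  assumes "A \<subseteq> dihedral_set B B" and "z = 0 \<or> z = 1"
  shows "Pair z -` A \<subseteq> B"
  using assms by auto

lemma sum_signs_dihedral_set:
  assumes "finite R" "finite F"
  shows "(\<Sum>b\<in>dihedral_set R F. if fst b = 0 then 1 else -1) = real (card R) - real (card F)"
proof -
  let ?\<sigma> = "\<lambda>b :: int \<times> 'a. if fst b = 0 then 1 else (-1 :: real)"
  have "sum ?\<sigma> (dihedral_set R F) = sum ?\<sigma> (Pair 0 ` R) + sum ?\<sigma> (Pair 1 ` F)"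
    unfolding dihedral_set_def
    by (rule sum.union_disjoint) (simp_all add: assms disjoint_iff image_iff)
  also have "sum ?\<sigma> (Pair 0 ` R) = real (card R)"
    by (subst sum.reindex) (simp_all add: inj_on_def)
  also have "sum ?\<sigma> (Pair 1 ` F) = - real (card F)"
    by (subst sum.reindex) (simp_all add: inj_on_def)
  finally show ?thesis
    by simp
qed

context comm_group
begin

text \<open>
  In every relation one element is determined by the others, so four distinct elements allow \<open>n ^ 3\<close>
  choices and three allow \<open>n ^ 2\<close>.  When only the square of an element is prescribed, there
  are up to \<open>j\<close> choices for it.
\<close>

lemma card_coincidences_le:
  assumes B: "finite B" "B \<subseteq> carrier G" "card B = n"
    and roots: "\<And>c. c \<in> carrier G \<Longrightarrow> card {x \<in> B. x \<otimes> x = c} \<le> j"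
  shows "card (mixed_quads B B) \<le> n ^ 3" "card (quotient_quads B B) \<le> n ^ 3"
    "card (rotation_quads B) \<le> n ^ 3" "card (mixed_squares B B) \<le> n ^ 2"
    "card (mixed_inverses B B) \<le> n ^ 2" "card (rotation_squares B) \<le> n ^ 2"
    "card (mixed_involutions B B) \<le> j * n" "card (equal_squares B) \<le> j * n"
proof -
  have mem: "x \<in> carrier G" if "x \<in> B" for x
    using that B by blast
  have lc: "y = z" if "x \<in> B" "y \<in> B" "z \<in> B" "x \<otimes> y = x \<otimes> z" for x y z
    using that mem l_cancel by blast
  have rc: "y = z" if "x \<in> B" "y \<in> B" "z \<in> B" "y \<otimes> x = z \<otimes> x" for x y z
    using that mem r_cancel by blast
  have cube: "card W \<le> n ^ 3" if "inj_on h W" "h ` W \<subseteq> B \<times> B \<times> B"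
    for h :: "'a \<times> 'a \<times> 'a \<times> 'a \<Rightarrow> 'a \<times> 'a \<times> 'a" and W
    using card_inj_on_le[OF that] B by (simp add: card_cartesian_product power3_eq_cube mult.assoc)
  have square: "card W \<le> n ^ 2" if "inj_on h W" "h ` W \<subseteq> B \<times> B"
    for h :: "'a \<times> 'a \<times> 'a \<Rightarrow> 'a \<times> 'a" and W
    using card_inj_on_le[OF that] B by (simp add: card_cartesian_product power2_eq_square)
  show "card (mixed_quads B B) \<le> n ^ 3"
    by (rule cube[of "\<lambda>(x, y, f, g). (x, y, f)"]) (auto simp: mixed_quads_def inj_on_def)
  show "card (quotient_quads B B) \<le> n ^ 3"
    by (rule cube[of "\<lambda>(x, y, f, g). (x, y, f)"])
      (auto simp: quotient_quads_def inj_on_def intro: rc)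
  show "card (rotation_quads B) \<le> n ^ 3"
    by (rule cube[of "\<lambda>(x, y, u, v). (x, y, u)"])
      (auto simp: rotation_quads_def inj_on_def intro: lc)
  show "card (mixed_squares B B) \<le> n ^ 2"
    by (rule square[of "\<lambda>(x, f, g). (x, f)"]) (auto simp: mixed_squares_def inj_on_def)
  show "card (mixed_inverses B B) \<le> n ^ 2"
    by (rule square[of "\<lambda>(x, y, f). (x, f)"])
      (auto simp: mixed_inverses_def inj_on_def intro: lc)
  show "card (rotation_squares B) \<le> n ^ 2"
    by (rule square[of "\<lambda>(x, u, v). (x, u)"])
      (auto simp: rotation_squares_def inj_on_def intro: lc)
  have "mixed_involutions B B = {x \<in> B. x \<otimes> x = \<one>} \<times> B"
    by (auto simp: mixed_involutions_def)
  then show "card (mixed_involutions B B) \<le> j * n"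
    using roots[of \<one>] B by (simp add: card_cartesian_product)
  have "equal_squares B \<subseteq> prod.swap ` (SIGMA y:B. {x \<in> B. x \<otimes> x = y \<otimes> y})"
    by (auto simp: equal_squares_def)
  moreover have fin: "finite (SIGMA y:B. {x \<in> B. x \<otimes> x = y \<otimes> y})"
    using B by simp
  ultimately have "card (equal_squares B) \<le> card (SIGMA y:B. {x \<in> B. x \<otimes> x = y \<otimes> y})"
    by (meson card_image_le card_mono finite_imageI le_trans)
  also have "\<dots> = (\<Sum>y\<in>B. card {x \<in> B. x \<otimes> x = y \<otimes> y})"
    using B by simp
  also have "\<dots> \<le> of_nat (card B) * j"
    by (rule sum_bounded_above) (use roots mem in auto)
  finally show "card (equal_squares B) \<le> j * n"
    using B by (simp add: mult.commute)
qed

text \<open>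
  With \<open>p = m / (2 n)\<close>, the expected number of coincidences is at most
  \<open>6 n\<^sup>3 p\<^sup>4 + 10 n\<^sup>2 p\<^sup>3 + 6 j n p\<^sup>2\<close>, the coefficients being the total multiplicities of the relations with
  four, three and two distinct elements.
\<close>

lemma sum_coincidences_le:
  assumes B: "finite B" "B \<subseteq> carrier G" "card B = n"
    and roots: "\<And>c. c \<in> carrier G \<Longrightarrow> card {x \<in> B. x \<otimes> x = c} \<le> j"
    and m: "m \<le> 2 * n" "0 < n"
  shows "(\<Sum>A | A \<subseteq> dihedral_set B B \<and> card A = m.
      real (coincidences (Pair 0 -` A) (Pair 1 -` A)))
    \<le> real ((2 * n) choose m)
        * ((3 / 8 * real m ^ 4 + 5 / 4 * real m ^ 3 + 3 / 2 * real j * real m ^ 2) / real n)"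
proof -
  let ?U = "dihedral_set B B"
  let ?S = "{A. A \<subseteq> ?U \<and> card A = m}"
  let ?T = "real (card ?U choose m)"
  define p where "p = real m / real (card ?U)"
  have U: "finite ?U" "card ?U = 2 * n"
    using B by (simp_all add: card_dihedral_set) (simp add: dihedral_set_def)
  have mU: "m \<le> card ?U"
    using U m by simp
  have sub: "Pair 0 -` A \<subseteq> B" "Pair 1 -` A \<subseteq> B" if "A \<subseteq> ?U" for A
    using that by (simp_all add: vimage_subset_of_dihedral_set)
  note expect = sum_card_supported_le[OF U(1) mU, folded p_def]
  note fin = finite_coincidences[OF B(1) B(1)]
  note card_le = card_coincidences_le[OF B roots]
  have a1: "(\<Sum>A\<in>?S. real (card (mixed_quads (Pair 0 -` A) (Pair 1 -` A)))) \<le> ?T * (real (n ^ 3) * p ^ 4)"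
    by (rule expect[OF fin(1) card_le(1), where supp = "\<lambda>(x, y, f, g). {(0, x), (0, y), (1, f), (1, g)}"])
      (use sub in \<open>auto simp: mixed_quads_def\<close>)
  have c1: "(\<Sum>A\<in>?S. real (card (quotient_quads (Pair 0 -` A) (Pair 1 -` A)))) \<le> ?T * (real (n ^ 3) * p ^ 4)"
    by (rule expect[OF fin(8) card_le(2), where supp = "\<lambda>(x, y, f, g). {(0, x), (0, y), (1, f), (1, g)}"])
      (use sub in \<open>auto simp: quotient_quads_def\<close>)
  have b1: "(\<Sum>A\<in>?S. real (card (rotation_quads (Pair 0 -` A)))) \<le> ?T * (real (n ^ 3) * p ^ 4)"
    by (rule expect[OF fin(5) card_le(3), where supp = "\<lambda>(x, y, u, v). {(0, x), (0, y), (0, u), (0, v)}"])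
      (use sub in \<open>auto simp: rotation_quads_def\<close>)
  have a2: "(\<Sum>A\<in>?S. real (card (mixed_squares (Pair 0 -` A) (Pair 1 -` A)))) \<le> ?T * (real (n ^ 2) * p ^ 3)"
    by (rule expect[OF fin(2) card_le(4), where supp = "\<lambda>(x, f, g). {(0, x), (1, f), (1, g)}"])
      (use sub in \<open>auto simp: mixed_squares_def\<close>)
  have a3: "(\<Sum>A\<in>?S. real (card (mixed_inverses (Pair 0 -` A) (Pair 1 -` A)))) \<le> ?T * (real (n ^ 2) * p ^ 3)"
    by (rule expect[OF fin(3) card_le(5), where supp = "\<lambda>(x, y, f). {(0, x), (0, y), (1, f)}"])
      (use sub in \<open>auto simp: mixed_inverses_def\<close>)
  have b2: "(\<Sum>A\<in>?S. real (card (rotation_squares (Pair 0 -` A)))) \<le> ?T * (real (n ^ 2) * p ^ 3)"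
    by (rule expect[OF fin(6) card_le(6), where supp = "\<lambda>(x, u, v). {(0, x), (0, u), (0, v)}"])
      (use sub in \<open>auto simp: rotation_squares_def\<close>)
  have a4: "(\<Sum>A\<in>?S. real (card (mixed_involutions (Pair 0 -` A) (Pair 1 -` A)))) \<le> ?T * (real (j * n) * p ^ 2)"
    by (rule expect[OF fin(4) card_le(7), where supp = "\<lambda>(x, f). {(0, x), (1, f)}"])
      (use sub in \<open>auto simp: mixed_involutions_def\<close>)
  have b4: "(\<Sum>A\<in>?S. real (card (equal_squares (Pair 0 -` A)))) \<le> ?T * (real (j * n) * p ^ 2)"
    by (rule expect[OF fin(7) card_le(8), where supp = "\<lambda>(x, y). {(0, x), (0, y)}"])
      (use sub in \<open>auto simp: equal_squares_def\<close>)
  have "(\<Sum>A\<in>?S. real (coincidences (Pair 0 -` A) (Pair 1 -` A)))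
    = 3 * (\<Sum>A\<in>?S. real (card (mixed_quads (Pair 0 -` A) (Pair 1 -` A))))
      + 2 * (\<Sum>A\<in>?S. real (card (quotient_quads (Pair 0 -` A) (Pair 1 -` A))))
      + (\<Sum>A\<in>?S. real (card (rotation_quads (Pair 0 -` A))))
      + 4 * (\<Sum>A\<in>?S. real (card (mixed_squares (Pair 0 -` A) (Pair 1 -` A))))
      + 3 * (\<Sum>A\<in>?S. real (card (mixed_inverses (Pair 0 -` A) (Pair 1 -` A))))
      + 3 * (\<Sum>A\<in>?S. real (card (rotation_squares (Pair 0 -` A))))
      + 4 * (\<Sum>A\<in>?S. real (card (mixed_involutions (Pair 0 -` A) (Pair 1 -` A))))
      + 2 * (\<Sum>A\<in>?S. real (card (equal_squares (Pair 0 -` A))))"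
    unfolding coincidences_def of_nat_add of_nat_mult of_nat_numeral sum.distrib sum_distrib_left ..
  also have "\<dots> \<le> 6 * (?T * (real (n ^ 3) * p ^ 4)) + 10 * (?T * (real (n ^ 2) * p ^ 3))
      + 6 * (?T * (real (j * n) * p ^ 2))"
    using a1 a2 a3 a4 b1 b2 b4 c1 by linarith
  also have "\<dots> = ?T * (6 * (real (n ^ 3) * p ^ 4) + 10 * (real (n ^ 2) * p ^ 3)
      + 6 * (real (j * n) * p ^ 2))"
    by (simp add: distrib_left)
  also have "6 * (real (n ^ 3) * p ^ 4) + 10 * (real (n ^ 2) * p ^ 3) + 6 * (real (j * n) * p ^ 2)
    = (3 / 8 * real m ^ 4 + 5 / 4 * real m ^ 3 + 3 / 2 * real j * real m ^ 2) / real n"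
    using m by (simp add: p_def U(2) field_simps power2_eq_square power3_eq_cube power4_eq_xxxx)
  finally show ?thesis
    unfolding U(2) .
qed

end

section \<open>More than half of the sets have more sums than differences\<close>

text \<open>
  With \<open>m = r + f\<close> and \<open>d = r - f\<close>, \<open>4 r (2 f + 3 - r) = (m + d) (m + 6 - 3 d)\<close>.  For \<open>m \<ge> 3\<close> this is
  positive as soon as \<open>3 |d| < m + 6\<close>, so a set without surplus is either unbalanced to that extent or
  has a coincidence.  The weight below is at least \<open>1\<close> in both cases.
\<close>

lemma exceptional_imp_weight_ge_1:
  fixes r f L :: nat
  assumes "6 \<le> r + f" and "int r * (2 * int f + 3 - int r) \<le> int L"
  shows "1 \<le> 9 * (real r - real f)\<^sup>2 / (real (r + f) + 6)\<^sup>2 + real L"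
proof (cases "L = 0")
  case False
  have "0 \<le> 9 * (real r - real f)\<^sup>2 / (real (r + f) + 6)\<^sup>2"
    by simp
  with False show ?thesis
    by linarith
next
  case True
  with assms have "r = 0 \<or> 2 * int f + 3 \<le> int r"
    by (auto simp: mult_le_0_iff)
  then have "real (r + f) + 6 \<le> 3 * \<bar>real r - real f\<bar>"
  proof
    assume "r = 0"
    then show ?thesis
      using assms(1) by simp
  next
    assume "2 * int f + 3 \<le> int r"
    then have "2 * real f + 3 \<le> real r"
      by linarith
    then show ?thesis
      by simp
  qed
  then have "(real (r + f) + 6)\<^sup>2 \<le> (3 * \<bar>real r - real f\<bar>)\<^sup>2"
    by (intro power_mono) auto
  then have "(real (r + f) + 6)\<^sup>2 \<le> 9 * (real r - real f)\<^sup>2"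
    by (simp add: power_mult_distrib)
  moreover have "0 < (real (r + f) + 6)\<^sup>2"
    by (rule zero_less_power) linarith
  ultimately show ?thesis
    by (simp add: True le_divide_eq)
qed

text \<open>
  For large \<open>m\<close> the surplus of order \<open>m\<^sup>2\<close> can absorb many coincidences.  The term linear in \<open>d\<close> of
  \<open>(m + d) (m + 6 - 3 d)\<close> is traded for a large multiple of \<open>d\<^sup>2\<close>, which has small expectation,
  at the price of only \<open>1 / 16\<close> of the leading term \<open>m\<^sup>2\<close>.
\<close>

lemma exceptional_imp_weight_ge_square:
  fixes r f L :: nat
  assumes "int r * (2 * int f + 3 - int r) \<le> int L"
  shows "15 * (real (r + f))\<^sup>2 \<le> 304 * (real r - real f)\<^sup>2 + 64 * real L"
proof -
  have "real_of_int (int r * (2 * int f + 3 - int r)) \<le> real_of_int (int L)"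
    using assms by (rule iffD2[OF of_int_le_iff])
  then have "64 * (real r * (2 * real f + 3 - real r)) \<le> 64 * real L"
    by simp
  moreover have "304 * (real r - real f)\<^sup>2 + 64 * (real r * (2 * real f + 3 - real r))
      - 15 * (real (r + f))\<^sup>2 = (real (r + f) - 16 * (real r - real f))\<^sup>2 + 192 * real r"
    by (simp add: power2_eq_square algebra_simps)
  moreover have "0 \<le> (real (r + f) - 16 * (real r - real f))\<^sup>2 + 192 * real r"
    by simp
  ultimately show ?thesis
    by linarith
qed

text \<open>
  The first summand is at most \<open>3 / 8\<close> because \<open>(m + 6)\<^sup>2 - 24 m = (m - 6)\<^sup>2\<close>.  The coincidences contribute
  less than the remaining \<open>1 / 8\<close>: the three coefficients add up to less than \<open>4\<close>, each monomial is at
  most \<open>j m\<^sup>4\<close>, and \<open>n > 32 j m\<^sup>4\<close>.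
\<close>

lemma small_weight_bound:
  assumes "0 < j" and "6 \<le> m" and "m < 1000 * j" and "32 * j * (1000 * j) ^ 4 \<le> n"
  shows "9 / (real m + 6)\<^sup>2 * real m
    + (3 / 8 * real m ^ 4 + 5 / 4 * real m ^ 3 + 3 / 2 * real j * real m ^ 2) / real n < 1 / 2"
proof -
  have m: "1 \<le> real m" and j: "1 \<le> real j"
    using assms by auto
  have "24 * real m \<le> (real m + 6)\<^sup>2"
    using zero_le_power2[of "real m - 6"] by (simp add: power2_eq_square algebra_simps)
  moreover have "0 < (real m + 6)\<^sup>2"
    by (rule zero_less_power) linarith
  ultimately have first: "9 / (real m + 6)\<^sup>2 * real m \<le> 3 / 8"
    by (simp add: field_simps)
  have jm: "real m ^ 4 \<le> real j * real m ^ 4" "real m ^ 3 \<le> real j * real m ^ 4"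
    "real j * real m ^ 2 \<le> real j * real m ^ 4"
  proof -
    show *: "real m ^ 4 \<le> real j * real m ^ 4"
      using mult_right_mono[OF j, of "real m ^ 4"] by simp
    have "real m ^ 3 \<le> real m ^ 4"
      by (rule power_increasing) (use m in auto)
    with * show "real m ^ 3 \<le> real j * real m ^ 4"
      by linarith
    have "real m ^ 2 \<le> real m ^ 4"
      by (rule power_increasing) (use m in auto)
    then show "real j * real m ^ 2 \<le> real j * real m ^ 4"
      by (rule mult_left_mono) simp
  qed
  have "real m ^ 4 < real (1000 * j) ^ 4"
    using assms by (intro power_strict_mono) auto
  then have "real j * real m ^ 4 < real j * real (1000 * j) ^ 4"
    using j by simp
  moreover have "32 * (real j * real (1000 * j) ^ 4) \<le> real n"
    using of_nat_mono[OF assms(4), where 'a = real] by (simp add: mult.assoc)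
  ultimately have "32 * (real j * real m ^ 4) < real n"
    by linarith
  moreover have "0 \<le> real j * real m ^ 4"
    by simp
  ultimately have "3 / 8 * real m ^ 4 + 5 / 4 * real m ^ 3 + 3 / 2 * (real j * real m ^ 2)
      < 1 / 8 * real n"
    using jm by linarith
  moreover have "0 < real n"
    using \<open>32 * (real j * real m ^ 4) < real n\<close> \<open>0 \<le> real j * real m ^ 4\<close> by linarith
  ultimately have "(3 / 8 * real m ^ 4 + 5 / 4 * real m ^ 3 + 3 / 2 * real j * real m ^ 2) / real n
      < 1 / 8"
    by (simp add: divide_less_eq mult.assoc)
  with first show ?thesis
    by linarith
qed

text \<open>
  Since \<open>1 / n \<le> 2 / (7 m\<^sup>2)\<close>, the left-hand side is at most \<open>64 * (3 / 8) * (2 / 7) / 15 = 16 / 35\<close>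
  plus terms of lower order, which \<open>m \<ge> 1000 j\<close> makes smaller than the gap between \<open>16 / 35\<close> and \<open>1 / 2\<close>.
\<close>

lemma large_weight_bound:
  assumes "0 < j" and "1000 * j \<le> m" and "7 * m ^ 2 \<le> 2 * n"
  shows "(304 * real m
      + 64 * ((3 / 8 * real m ^ 4 + 5 / 4 * real m ^ 3 + 3 / 2 * real j * real m ^ 2) / real n))
    / (15 * (real m)\<^sup>2) < 1 / 2"
proof -
  have m: "1000 \<le> real m" and jm: "1000 * real j \<le> real m"
    using assms by auto
  have mn: "real m ^ 2 \<le> 2 / 7 * real n"
    using of_nat_mono[OF assms(3), where 'a = real] by simp
  have m2: "0 < real m ^ 2"
    using m by simp
  with mn have n: "0 < real n"
    by linarith
  have "(3 / 8 * real m ^ 4 + 5 / 4 * real m ^ 3 + 3 / 2 * real j * real m ^ 2)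
      = real m ^ 2 * (3 / 8 * real m ^ 2 + 5 / 4 * real m + 3 / 2 * real j)"
    by (simp add: power2_eq_square power3_eq_cube power4_eq_xxxx algebra_simps)
  also have "\<dots> \<le> 2 / 7 * real n * (3 / 8 * real m ^ 2 + 5 / 4 * real m + 3 / 2 * real j)"
    by (rule mult_right_mono[OF mn]) simp
  finally have "(3 / 8 * real m ^ 4 + 5 / 4 * real m ^ 3 + 3 / 2 * real j * real m ^ 2) / real n
      \<le> 2 / 7 * (3 / 8 * real m ^ 2 + 5 / 4 * real m + 3 / 2 * real j)"
    using n by (simp add: divide_le_eq mult_ac)
  moreover have "1000 * real m \<le> real m ^ 2"
    using mult_right_mono[OF m, of "real m"] by (simp add: power2_eq_square)
  ultimately have "304 * real m
      + 64 * ((3 / 8 * real m ^ 4 + 5 / 4 * real m ^ 3 + 3 / 2 * real j * real m ^ 2) / real n)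
      < 15 / 2 * (real m)\<^sup>2"
    using jm m unfolding distrib_left by linarith
  then show ?thesis
    using m2 by (simp add: divide_less_eq)
qed

context comm_group
begin

lemma sum_coincidence_weights_le:
  assumes B: "finite B" "B \<subseteq> carrier G" "card B = n"
    and roots: "\<And>c. c \<in> carrier G \<Longrightarrow> card {x \<in> B. x \<otimes> x = c} \<le> j"
    and m: "2 \<le> m" "m \<le> 2 * n" "0 < n" and a: "0 \<le> a" and b: "0 \<le> b"
  shows "(\<Sum>A | A \<subseteq> dihedral_set B B \<and> card A = m.
      a * (real (card (Pair 0 -` A)) - real (card (Pair 1 -` A)))\<^sup>2
      + b * real (coincidences (Pair 0 -` A) (Pair 1 -` A)))
    \<le> real ((2 * n) choose m) * (a * real m
        + b * ((3 / 8 * real m ^ 4 + 5 / 4 * real m ^ 3 + 3 / 2 * real j * real m ^ 2) / real n))"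
proof -
  let ?U = "dihedral_set B B"
  let ?S = "{A. A \<subseteq> ?U \<and> card A = m}"
  let ?\<sigma> = "\<lambda>b :: int \<times> 'a. if fst b = 0 then 1 else (-1 :: real)"
  have U: "finite ?U" "card ?U = 2 * n"
    using B by (simp_all add: card_dihedral_set) (simp add: dihedral_set_def)
  have "(\<Sum>A\<in>?S. (real (card (Pair 0 -` A)) - real (card (Pair 1 -` A)))\<^sup>2)
      = (\<Sum>A\<in>?S. (sum ?\<sigma> A)\<^sup>2)"
  proof (rule sum.cong[OF refl])
    fix A assume "A \<in> ?S"
    then have A: "A \<subseteq> ?U"
      by simp
    have fin: "finite (Pair 0 -` A)" "finite (Pair 1 -` A)"
      using finite_subset[OF vimage_subset_of_dihedral_set[OF A] B(1)] by simp_all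
    show "(real (card (Pair 0 -` A)) - real (card (Pair 1 -` A)))\<^sup>2 = (sum ?\<sigma> A)\<^sup>2"
      using sum_signs_dihedral_set[OF fin] dihedral_set_vimage[OF A] by simp
  qed
  also have "\<dots> \<le> real (card ?U choose m) * real m"
    by (rule sum_square_balanced_signs_le[OF U(1)])
      (use U m B sum_signs_dihedral_set[OF B(1) B(1)] in auto)
  finally have sq: "(\<Sum>A\<in>?S. (real (card (Pair 0 -` A)) - real (card (Pair 1 -` A)))\<^sup>2)
      \<le> real ((2 * n) choose m) * real m"
    unfolding U(2) .
  note mult_left_mono[OF this a]
    and mult_left_mono[OF sum_coincidences_le[OF B roots m(2,3)] b]
  from add_mono[OF this] show ?thesis
    by (simp add: sum.distrib sum_distrib_left distrib_left mult_ac)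
qed

text \<open>
  By Markov's inequality for the weight \<open>a d\<^sup>2 + b L\<close>, where \<open>L\<close> is the number of coincidences, fewer than
  half of the sets are in \<open>bad\<close>.  The other sets are MSTD and all MDTS sets are in \<open>bad\<close>.  The
  weights depend on the size of \<open>m\<close>: small sets have practically no coincidences but may well be
  unbalanced, whereas large sets are almost balanced but have many coincidences.
\<close>

lemma card_MDTS_less_card_MSTD:
  assumes B: "finite B" "B \<subseteq> carrier G" "card B = n"
    and roots: "\<And>c. c \<in> carrier G \<Longrightarrow> card {x \<in> B. x \<otimes> x = c} \<le> j"
    and j: "0 < j" and n: "32 * j * (1000 * j) ^ 4 \<le> n"
    and m: "6 \<le> m" "7 * m ^ 2 \<le> 2 * n"
  shows "card {A. A \<subseteq> dihedral_set B B \<and> card A = m \<and> MDTS (Dih G) A}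
    < card {A. A \<subseteq> dihedral_set B B \<and> card A = m \<and> MSTD (Dih G) A}"
proof -
  let ?U = "dihedral_set B B"
  define S where "S = {A. A \<subseteq> ?U \<and> card A = m}"
  define r f L where "r A = card (Pair (0::int) -` A)" and "f A = card (Pair (1::int) -` A)"
    and "L A = coincidences (Pair 0 -` A) (Pair 1 -` A)" for A :: "(int \<times> 'a) set"
  define bad where "bad = {A \<in> S. int (r A) * (2 * int (f A) + 3 - int (r A)) \<le> int (L A)}"
  let ?E = "(3 / 8 * real m ^ 4 + 5 / 4 * real m ^ 3 + 3 / 2 * real j * real m ^ 2) / real n"
  have U: "finite ?U" "card ?U = 2 * n"
    using B by (simp_all add: card_dihedral_set) (simp add: dihedral_set_def)
  have S: "finite S" "card S = (2 * n) choose m"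
    using U n_subsets[of ?U m] by (simp_all add: S_def)
  have "m \<le> m ^ 2"
    by (simp add: power2_eq_square)
  with m have mn: "m \<le> 2 * n" "0 < n"
    by linarith+
  then have T: "0 < real ((2 * n) choose m)"
    by simp
  have split: "A = dihedral_set (Pair 0 -` A) (Pair 1 -` A)" "Pair 0 -` A \<subseteq> B" "Pair 1 -` A \<subseteq> B"
    "finite (Pair 0 -` A)" "finite (Pair 1 -` A)" "r A + f A = m" if "A \<in> S" for A
  proof -
    have A: "A \<subseteq> ?U" "card A = m"
      using that by (auto simp: S_def)
    show *: "A = dihedral_set (Pair 0 -` A) (Pair 1 -` A)"
      by (rule dihedral_set_vimage[OF A(1)])
    show sub: "Pair 0 -` A \<subseteq> B" "Pair 1 -` A \<subseteq> B"
      using vimage_subset_of_dihedral_set[OF A(1)] by simp_all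
    show fin: "finite (Pair 0 -` A)" "finite (Pair 1 -` A)"
      using sub[THEN finite_subset, OF B(1)] by simp_all
    show "r A + f A = m"
      using card_dihedral_set[OF fin] A(2) *[symmetric] by (simp add: r_def f_def)
  qed
  have MSTD: "MSTD (Dih G) A" if "A \<in> S - bad" for A
  proof -
    have A: "A \<in> S" "int (L A) < int (r A) * (2 * int (f A) + 3 - int (r A))"
      using that by (auto simp: bad_def)
    \<comment> \<open>A set consisting of rotations only has negative surplus \<open>m (3 - m)\<close>.\<close>
    have "Pair 1 -` A \<noteq> {}"
    proof
      assume "Pair 1 -` A = {}"
      then have "f A = 0" "r A = m"
        using split(6)[OF A(1)] by (simp_all add: f_def)
      then have "int (r A) * (2 * int (f A) + 3 - int (r A)) \<le> 0"
        using m by (auto simp: mult_le_0_iff)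
      with A(2) show False
        by linarith
    qed
    then have "MSTD (Dih G) (dihedral_set (Pair 0 -` A) (Pair 1 -` A))"
      using split[OF A(1)] A(2) B(2)
      by (intro MSTD_dihedral_set) (auto simp: r_def f_def L_def)
    then show ?thesis
      using split(1)[OF A(1)] by simp
  qed
  have markov: "2 * card bad < card S"
    if ab: "0 \<le> a" "0 \<le> b" and lt: "a * real m + b * ?E < 1 / 2"
      and weight: "\<And>A. A \<in> bad \<Longrightarrow> 1 \<le> a * (real (r A) - real (f A))\<^sup>2 + b * real (L A)"
    for a b :: real
  proof -
    let ?w = "\<lambda>A. a * (real (r A) - real (f A))\<^sup>2 + b * real (L A)"
    have "real (card bad) = (\<Sum>A\<in>bad. 1)"
      by simp
    also have "\<dots> \<le> (\<Sum>A\<in>bad. ?w A)"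
      by (rule sum_mono) (use weight in auto)
    also have "\<dots> \<le> (\<Sum>A\<in>S. ?w A)"
      by (rule sum_mono2) (use S ab in \<open>auto simp: bad_def\<close>)
    also have "\<dots> \<le> real ((2 * n) choose m) * (a * real m + b * ?E)"
      unfolding S_def r_def f_def L_def
      by (rule sum_coincidence_weights_le[OF B roots _ mn ab]) (use m in auto)
    also have "\<dots> < real ((2 * n) choose m) * (1 / 2)"
      using T lt by (intro mult_strict_left_mono)
    finally show ?thesis
      using S(2) by linarith
  qed
  have "2 * card bad < card S"
  proof (cases "m < 1000 * j")
    case True
    show ?thesis
    proof (rule markov)
      show "9 / (real m + 6)\<^sup>2 * real m + 1 * ?E < 1 / 2"
        using small_weight_bound[OF j m(1) True n] by simp
      fix A assume "A \<in> bad"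
      then have "A \<in> S" "int (r A) * (2 * int (f A) + 3 - int (r A)) \<le> int (L A)"
        by (auto simp: bad_def)
      then show "1 \<le> 9 / (real m + 6)\<^sup>2 * (real (r A) - real (f A))\<^sup>2 + 1 * real (L A)"
        using exceptional_imp_weight_ge_1[of "r A" "f A" "L A"] split(6)[of A] m by simp
    qed simp_all
  next
    case False
    show ?thesis
    proof (rule markov)
      show "304 / (15 * (real m)\<^sup>2) * real m + 64 / (15 * (real m)\<^sup>2) * ?E < 1 / 2"
        using large_weight_bound[OF j _ m(2)] False by (simp add: add_divide_distrib)
      fix A assume "A \<in> bad"
      then have "A \<in> S" "int (r A) * (2 * int (f A) + 3 - int (r A)) \<le> int (L A)"
        by (auto simp: bad_def)
      then have "15 * (real m)\<^sup>2 \<le> 304 * (real (r A) - real (f A))\<^sup>2 + 64 * real (L A)"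
        using exceptional_imp_weight_ge_square[of "r A" "f A" "L A"] split(6)[of A] by simp
      moreover have "0 < 15 * (real m)\<^sup>2"
        using m by simp
      ultimately have "1 \<le> (304 * (real (r A) - real (f A))\<^sup>2 + 64 * real (L A)) / (15 * (real m)\<^sup>2)"
        by (simp only: le_divide_eq_1_pos)
      then show "1 \<le> 304 / (15 * (real m)\<^sup>2) * (real (r A) - real (f A))\<^sup>2
          + 64 / (15 * (real m)\<^sup>2) * real (L A)"
        by (simp add: add_divide_distrib)
    qed simp_all
  qed
  moreover have "card {A. A \<subseteq> ?U \<and> card A = m \<and> MDTS (Dih G) A} \<le> card bad"
  proof (rule card_mono)
    show "finite bad"
      using S by (simp add: bad_def)
    show "{A. A \<subseteq> ?U \<and> card A = m \<and> MDTS (Dih G) A} \<subseteq> bad"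
    proof
      fix A assume "A \<in> {A. A \<subseteq> ?U \<and> card A = m \<and> MDTS (Dih G) A}"
      then have "A \<in> S" "\<not> MSTD (Dih G) A"
        by (simp_all add: S_def MSTD_def MDTS_def)
      then show "A \<in> bad"
        using MSTD by blast
    qed
  qed
  moreover have "card (S - bad) \<le> card {A. A \<subseteq> ?U \<and> card A = m \<and> MSTD (Dih G) A}"
  proof (rule card_mono)
    have "{A. A \<subseteq> ?U \<and> card A = m \<and> MSTD (Dih G) A} \<subseteq> S"
      by (auto simp: S_def)
    then show "finite {A. A \<subseteq> ?U \<and> card A = m \<and> MSTD (Dih G) A}"
      using S(1) by (rule finite_subset)
    show "S - bad \<subseteq> {A. A \<subseteq> ?U \<and> card A = m \<and> MSTD (Dih G) A}"
      using MSTD by (auto simp: S_def)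
  qed
  moreover have "card S = card bad + card (S - bad)"
    by (rule card_subset_add_card_Diff) (use S in \<open>auto simp: bad_def\<close>)
  ultimately show ?thesis
    by linarith
qed

end

section \<open>Sums of cyclic groups\<close>

text \<open>
  The coordinates of the finite group are representatives of residues, so its elements are literally
  the elements of the infinite group in the box.
\<close>

lemma Dih_box_eq_dihedral_set:
  fixes k :: nat and r q :: "nat \<Rightarrow> nat"
  assumes "\<alpha> > 0"
  defines "B \<equiv> carrier (sum_of_cyclic (integer_mod_group \<alpha>) k r q)"
  shows "Dih_box \<alpha> k r q = dihedral_set B B" and "B \<subseteq> carrier (fg_group k r q)"
proof -
  define I where "I = (SIGMA a:{0..k}. {1..r a})"
  define C where "C = (\<lambda>(a, b::nat). if a = 0 then integer_group else integer_mod_group (q a))"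
  define C' where "C' = (\<lambda>(a, b::nat). if a = 0 then integer_mod_group \<alpha> else integer_mod_group (q a))"
  have carriers: "carrier (fg_group k r q) = (\<Pi>\<^sub>E i\<in>I. carrier (C i))"
    "B = (\<Pi>\<^sub>E i\<in>I. carrier (C' i))"
    by (simp_all add: B_def sum_of_cyclic_def I_def C_def C'_def)
  have coordinate: "y \<in> carrier (C' i)
      \<longleftrightarrow> y \<in> carrier (C i) \<and> (fst i = 0 \<longrightarrow> 0 \<le> y \<and> y < int \<alpha>)" for i y
    using assms(1)
    by (cases i) (simp add: C_def C'_def carrier_integer_mod_group integer_group_def)
  then show "B \<subseteq> carrier (fg_group k r q)"
    unfolding carriers by (intro PiE_mono subsetI) blast
  have zero_row: "(\<forall>i\<in>I. fst i = 0 \<longrightarrow> P (g i)) \<longleftrightarrow> (\<forall>b\<in>{1..r 0}. P (g (0, b)))"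
    for P and g :: "nat \<times> nat \<Rightarrow> int"
    by (fastforce simp: I_def)
  have "g \<in> B \<longleftrightarrow> g \<in> carrier (fg_group k r q) \<and> (\<forall>b\<in>{1..r 0}. 0 \<le> g (0, b) \<and> g (0, b) < int \<alpha>)"
    for g
    unfolding carriers PiE_iff coordinate ball_conj_distrib
      zero_row[of "\<lambda>y. 0 \<le> y \<and> y < int \<alpha>"] by blast
  then have "(z, g) \<in> Dih_box \<alpha> k r q \<longleftrightarrow> (z, g) \<in> dihedral_set B B" for z g
    by (auto simp: Dih_box_def Dih_def semidirect_product_def carrier_integer_mod_group)
  then show "Dih_box \<alpha> k r q = dihedral_set B B"
    by (simp add: set_eq_iff split_paired_all)
qed

text \<open>
  Reduction of the free coordinates modulo \<open>\<alpha>\<close> is multiplicative; every relation between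
  elements of the box thus persists in the finite group.
\<close>

lemma mult_sum_of_cyclic_integer_mod_group:
  "x \<otimes>\<^bsub>sum_of_cyclic (integer_mod_group \<alpha>) k r q\<^esub> y
    = (\<lambda>i\<in>(SIGMA a:{0..k}. {1..r a}).
        if fst i = 0 then (x \<otimes>\<^bsub>fg_group k r q\<^esub> y) i mod int \<alpha>
        else (x \<otimes>\<^bsub>fg_group k r q\<^esub> y) i)"
  unfolding sum_of_cyclic_def mult_product_group
  by (rule restrict_ext) (auto simp: integer_group_def split: if_splits)

text \<open>
  Dividing by one element with the given square maps all of them injectively to elements whose
  square is the identity.
\<close>

lemma card_equal_squares_le_card_involutions:
  fixes H (structure)
  assumes "comm_group H" and "finite (carrier H)" and "W \<subseteq> carrier H"
    and "\<And>x y. x \<in> W \<Longrightarrow> y \<in> W \<Longrightarrow> x \<otimes> x = y \<otimes> y"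
  shows "card W \<le> card {x \<in> carrier H. group.ord H x \<le> 2}"
proof (cases "W = {}")
  case False
  interpret comm_group H by fact
  from False obtain y where y: "y \<in> W"
    by blast
  then have yc: "y \<in> carrier H"
    using assms by blast
  show ?thesis
  proof (rule card_inj_on_le)
    show "inj_on (\<lambda>x. x \<otimes> inv y) W"
      using inj_on_subset[OF inj_on_multc[OF inv_closed[OF yc]] assms(3)] .
    show "(\<lambda>x. x \<otimes> inv y) ` W \<subseteq> {x \<in> carrier H. ord x \<le> 2}"
    proof
      fix z assume "z \<in> (\<lambda>x. x \<otimes> inv y) ` W"
      then obtain x where x: "x \<in> W" "z = x \<otimes> inv y"
        by blast
      then have xc: "x \<in> carrier H" and zc: "z \<in> carrier H"
        using assms yc by auto
      have "z \<otimes> z = (x \<otimes> x) \<otimes> (inv y \<otimes> inv y)"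
        using x xc yc by (simp add: m_ac)
      also have "\<dots> = (y \<otimes> y) \<otimes> inv (y \<otimes> y)"
        using assms(4)[OF x(1) y] yc by (simp add: inv_mult)
      finally have "z [^] (2::nat) = \<one>"
        using yc zc by (simp add: numeral_2_eq_2)
      then have "ord z dvd 2"
        using pow_eq_id[OF zc] by simp
      then show "z \<in> {x \<in> carrier H. ord x \<le> 2}"
        using zc by (simp add: dvd_imp_le)
    qed
    show "finite {x \<in> carrier H. ord x \<le> 2}"
      using assms(2) by simp
  qed
qed simp

theorem corollary3p7:
  fixes j :: nat and \<epsilon> :: real
  assumes "j > 0" and "\<epsilon> > 0"
  shows "\<exists>N::nat. \<forall>(k::nat) (r::nat \<Rightarrow> nat) (q::nat \<Rightarrow> nat) (\<alpha>::nat) (m::nat).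
    let G = fg_group k r q;
        G' = sum_of_cyclic (integer_mod_group \<alpha>) k r q;
        n = order G';
        S = {A. A \<subseteq> Dih_box \<alpha> k r q \<and> card A = m}
    in (\<forall>i\<in>{1..k}. primepow (q i)) \<longrightarrow>
       \<alpha> > 0 \<longrightarrow>
       card {x \<in> carrier G'. group.ord G' x \<le> 2} = j \<longrightarrow>
       n \<ge> N \<longrightarrow>
       6 \<le> m \<longrightarrow>
       real m \<le> (sqrt (2 / 7) - \<epsilon>) * sqrt (real n) \<longrightarrow>
       card {A \<in> S. MSTD (Dih G) A} > card {A \<in> S. MDTS (Dih G) A}"
proof (intro exI allI, unfold Let_def, intro impI)
  fix k :: nat and r q :: "nat \<Rightarrow> nat" and \<alpha> m :: nat
  define G where "G = fg_group k r q"
  define G' where "G' = sum_of_cyclic (integer_mod_group \<alpha>) k r q"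
  assume \<alpha>: "\<alpha> > 0"
    and "card {x \<in> carrier (sum_of_cyclic (integer_mod_group \<alpha>) k r q).
      group.ord (sum_of_cyclic (integer_mod_group \<alpha>) k r q) x \<le> 2} = j"
    and "32 * j * (1000 * j) ^ 4 \<le> order (sum_of_cyclic (integer_mod_group \<alpha>) k r q)"
    and m: "6 \<le> m"
    and "real m \<le> (sqrt (2 / 7) - \<epsilon>)
      * sqrt (real (order (sum_of_cyclic (integer_mod_group \<alpha>) k r q)))"
  then have order_two: "card {x \<in> carrier G'. group.ord G' x \<le> 2} = j"
    and n: "32 * j * (1000 * j) ^ 4 \<le> order G'"
    and mn: "real m \<le> (sqrt (2 / 7) - \<epsilon>) * sqrt (real (order G'))"
    unfolding G'_def by blast+
  interpret comm_group G
    unfolding G_def by (intro comm_group_sum_of_cyclic abelian_integer_group)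
  have comm': "comm_group G'"
    unfolding G'_def by (intro comm_group_sum_of_cyclic abelian_integer_mod_group)
  have "0 < 32 * j * (1000 * j) ^ 4"
    using assms(1) by simp
  then have fin: "finite (carrier G')"
    using n unfolding order_def by (intro card_ge_0_finite) (rule less_le_trans)
  note box = Dih_box_eq_dihedral_set[OF \<alpha>, of k r q, folded G'_def G_def]
  have roots: "card {x \<in> carrier G'. x \<otimes>\<^bsub>G\<^esub> x = c} \<le> j" if "c \<in> carrier G" for c
  proof -
    have "x \<otimes>\<^bsub>G'\<^esub> x = y \<otimes>\<^bsub>G'\<^esub> y" if "x \<otimes>\<^bsub>G\<^esub> x = c" "y \<otimes>\<^bsub>G\<^esub> y = c" for x y
      unfolding G'_def mult_sum_of_cyclic_integer_mod_group that[unfolded G_def] ..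
    then show ?thesis
      unfolding order_two[symmetric]
      by (intro card_equal_squares_le_card_involutions[OF comm' fin]) auto
  qed
  note mn
  also have "(sqrt (2 / 7) - \<epsilon>) * sqrt (real (order G')) \<le> sqrt (2 / 7) * sqrt (real (order G'))"
    by (rule mult_right_mono) (use assms(2) in simp_all)
  finally have "(real m)\<^sup>2 \<le> (sqrt (2 / 7) * sqrt (real (order G')))\<^sup>2"
    by (intro power_mono) auto
  then have "7 * (real m)\<^sup>2 \<le> 2 * real (order G')"
    by (simp add: power_mult_distrib)
  then have "real (7 * m\<^sup>2) \<le> real (2 * order G')"
    by simp
  then have "7 * m\<^sup>2 \<le> 2 * order G'"
    by (simp only: of_nat_le_iff)
  from card_MDTS_less_card_MSTD[OF fin box(2) order_def[symmetric] roots assms(1) n m this]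
  show "card {A \<in> {A. A \<subseteq> Dih_box \<alpha> k r q \<and> card A = m}. MDTS (Dih (fg_group k r q)) A}
    < card {A \<in> {A. A \<subseteq> Dih_box \<alpha> k r q \<and> card A = m}. MSTD (Dih (fg_group k r q)) A}"
    by (simp add: box(1) G_def conj_assoc)
qed

end
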